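(* Let $\alpha\in L^*/L$ and $n\in q(\alpha)+\mathbb{Z}$ with $n<0$, and let $s\in\mathbb{C}$ with $\mathrm{Re}(s)>\kappa/2$. Then the automorphic Green function $\Phi_{\alpha,n}(Z,s)$ satisfies the additive symmetry in $Z$: for every $N\in\mathbb{N}$, \[ \sum_{(a,b,d)\in\mathcal{H}_N}\Phi_{\alpha,n}\left(\left(\frac{az+b}{d},\frac{\sqrt{N}}{d}w,z'\right),s\right)=\sum_{(a,b,d)\in\mathcal{H}_N}\Phi_{\alpha,n}\left(\left(z,\frac{\sqrt{N}}{d}w,\frac{az'+b}{d}\right),s\right) \] as functions of $Z=(z,w,z')\in\mathcal{D}$ (away from the Heegner divisor where the terms are singular).
   Context: Let $m\ge 0$ and $S$ a positive definite even integral symmetric $m\times m$ matrix. For a symmetric matrix $T$ write $T(x,y)={}^t xTy$, $T[x]=T(x,x)$. Let $Q$ be the $(m+4)\times(m+4)$ symmetric matrix with $Q[x]=2x_1x_{m+4}+2x_2x_{m+3}-S[(x_3,\dots,x_{m+2})]$, $L=\mathbb{Z}^{m+4}$, $L^*=Q^{-1}L$, $q(x)=Q[x]/2$. For $Z=(z,w,z')$ put $Q_1[Z]=2zz'-S[w]$ and $\mathcal{D}=\{Z\in\mathfrak{H}\times\mathbb{C}^m\times\mathfrak{H}: Q_1[\mathrm{Im}Z]>0\}$; for $Z\in\mathcal{D}$ let $\widetilde Z={}^t(-Q_1[Z]/2,z,w,z',1)$ and, for $\lambda\in\mathbb{R}^{m+4}$, $q(\lambda_Z)=|Q(\lambda,\widetilde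 Z)|^2/(2Q_1[\mathrm{Im}Z])$. The Heegner divisor $H(\alpha,n)$ is the union of the sets $\{Z\in\mathcal{D}:Q(\lambda,\widetilde Z)=0\}$ over $\lambda\in\alpha+L$ with $q(\lambda)=n$. Put $\kappa=(m+4)/2$. For $Z\in\mathcal{D}\setminus H(\alpha,n)$ and $\mathrm{Re}(s)>\kappa/2$, \[ \Phi_{\alpha,n}(Z,s)=2\frac{\Gamma(s+\kappa/2-1)}{\Gamma(2s)}\sum_{\lambda\in\alpha+L,\,q(\lambda)=n}\left(\frac{n}{n-q(\lambda_Z)}\right)^{s+\kappa/2-1}F\left(s+\frac{\kappa}{2}-1,s-\frac{\kappa}{2}+1,2s;\frac{n}{n-q(\lambda_Z)}\right), \] where $F(a,b,c;z)=\sum_{k\ge0}\frac{(a)_k(b)_k}{(c)_k}\frac{z^k}{k!}$ is the Gauss hypergeometric function; the series converges locally uniformly. For $N\in\mathbb{N}$, $\mathcal{H}_N=\{(a,b,d)\in\mathbb{Z}^3:a,d>0,ad=N,0\le b<d\}$. *)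

theory Defs
  imports "HOL-Analysis.Gamma_Function" "HOL-Analysis.Infinite_Sum" "Jordan_Normal_Form.Matrix"
begin

unbundle no vec_syntax and no inner_syntax

type_synonym 'a triple = "'a \<times> 'a Matrix.vec \<times> 'a"

definition bilin :: "int mat \<Rightarrow> 'a::comm_ring_1 Matrix.vec \<Rightarrow> 'a Matrix.vec \<Rightarrow> 'a" where
  "bilin T x y = x \<bullet> (map_mat of_int T *\<^sub>v y)"

definition quad :: "int mat \<Rightarrow> 'a::comm_ring_1 Matrix.vec \<Rightarrow> 'a" where
  "quad T x = bilin T x x"

definition sym_mat :: "int mat \<Rightarrow> bool" where
  "sym_mat T \<longleftrightarrow> transpose_mat T = T"

definition even_mat :: "int mat \<Rightarrow> bool" where
  "even_mat T \<longleftrightarrow> (\<forall>x \<in> carrier_vec (dim_row T). even (quad T (x :: int Matrix.vec)))"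

definition pos_def_mat :: "int mat \<Rightarrow> bool" where
  "pos_def_mat T \<longleftrightarrow>
    (\<forall>x \<in> carrier_vec (dim_row T). x \<noteq> 0\<^sub>v (dim_row T) \<longrightarrow> quad T (x :: real Matrix.vec) > 0)"

text \<open>Throughout, \<open>m = dim_row S\<close>, and vectors and matrices are indexed from 0, so that
  \<open>x\<^sub>1, \<dots>, x\<^sub>m\<^sub>+\<^sub>4\<close> become the entries \<open>0, \<dots>, m + 3\<close>.\<close>

definition Qmat :: "int mat \<Rightarrow> int mat" where
  "Qmat S = (let m = dim_row S in
    mat (m + 4) (m + 4) (\<lambda>(i, j).
      if i \<in> {2..<m + 2} \<and> j \<in> {2..<m + 2} then - S $$ (i - 2, j - 2)
      else if i + j = m + 3 then 1 else 0))"

lemma quad_Qmat: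
  fixes x1 x2 x3 x4 :: "'a::comm_ring_1"
  assumes S: "S \<in> carrier_mat m m" and y: "y \<in> carrier_vec m"
  shows "quad (Qmat S) (vec_of_list [x1, x2] @\<^sub>v y @\<^sub>v vec_of_list [x3, x4])
    = 2 * x1 * x4 + 2 * x2 * x3 - quad S y"
proof -
  define X where "X = vec_of_list [x1, x2] @\<^sub>v y @\<^sub>v vec_of_list [x3, x4]"
  have dS: "dim_row S = m" "dim_col S = m" "dim_vec y = m" using S y by auto
  have dX: "dim_vec X = m + 4" by (simp add: X_def dS)
  have X: "X $ 0 = x1" "X $ 1 = x2" "X $ (Suc 0) = x2" "X $ (m + 2) = x3" "X $ (m + 3) = x4"
    "\<And>i. i < m \<Longrightarrow> X $ (i + 2) = y $ i"
    by (auto simp: X_def dS append_vec_def vec_of_list_index)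
  have split: "(\<Sum>i = 0..<m + 4. f i) =
      f 0 + f 1 + (\<Sum>i = 0..<m. f (i + 2)) + f (m + 2) + f (m + 3)" for f :: "nat \<Rightarrow> 'a"
  proof -
    have "(\<Sum>i = 0..<m + 4. f i) = f 0 + f 1 + (\<Sum>i = 2..<m + 4. f i)"
      by (simp add: sum.atLeast_Suc_lessThan numeral_2_eq_2 add.assoc)
    also have "(\<Sum>i = 2..<m + 4. f i) = (\<Sum>i = 0..<m + 2. f (i + 2))"
      using sum.shift_bounds_nat_ivl[of f 0 2 "m + 2"] by (simp add: eval_nat_numeral)
    also have "\<dots> = (\<Sum>i = 0..<m. f (i + 2)) + f (m + 2) + f (m + 3)"
      by (simp add: eval_nat_numeral)
    finally show ?thesis by (simp add: add.assoc)
  qed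
  define q where "q i j = (of_int (Qmat S $$ (i, j)) :: 'a)" for i j
  have expand: "quad (Qmat S) X = (\<Sum>i = 0..<m + 4. X $ i * (\<Sum>j = 0..<m + 4. q i j * X $ j))"
    by (simp add: quad_def bilin_def scalar_prod_def dX dS Qmat_def Let_def q_def)
  have q: "q 0 0 = 0" "q 0 1 = 0" "q 0 (m + 2) = 0" "q 0 (m + 3) = 1"
    "q 1 0 = 0" "q 1 1 = 0" "q 1 (m + 2) = 1" "q 1 (m + 3) = 0"
    "q (m + 2) 0 = 0" "q (m + 2) 1 = 1" "q (m + 2) (m + 2) = 0" "q (m + 2) (m + 3) = 0"
    "q (m + 3) 0 = 1" "q (m + 3) 1 = 0" "q (m + 3) (m + 2) = 0" "q (m + 3) (m + 3) = 0"
    "\<And>i. i < m \<Longrightarrow> q 0 (i + 2) = 0" "\<And>i. i < m \<Longrightarrow> q 1 (i + 2) = 0"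
    "\<And>i. i < m \<Longrightarrow> q (m + 2) (i + 2) = 0" "\<And>i. i < m \<Longrightarrow> q (m + 3) (i + 2) = 0"
    "\<And>i. i < m \<Longrightarrow> q (i + 2) 0 = 0" "\<And>i. i < m \<Longrightarrow> q (i + 2) 1 = 0"
    "\<And>i. i < m \<Longrightarrow> q (i + 2) (m + 2) = 0" "\<And>i. i < m \<Longrightarrow> q (i + 2) (m + 3) = 0"
    "\<And>i j. i < m \<Longrightarrow> j < m \<Longrightarrow> q (i + 2) (j + 2) = - of_int (S $$ (i, j))"
    by (auto simp: q_def Qmat_def Let_def dS)
  have S_form: "quad S y = (\<Sum>i = 0..<m. y $ i * (\<Sum>j = 0..<m. of_int (S $$ (i, j)) * y $ j))"
    by (simp add: quad_def bilin_def scalar_prod_def dS)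
  have outer: "(\<Sum>j = 0..<m. q r (j + 2) * X $ (j + 2)) = 0"
    if "r \<in> {0, 1, m + 2, m + 3}" for r
    using that q by (intro sum.neutral) fastforce
  have inner: "(\<Sum>i = 0..<m. X $ (i + 2) * (q (i + 2) 0 * X $ 0 + q (i + 2) 1 * X $ 1 +
      (\<Sum>j = 0..<m. q (i + 2) (j + 2) * X $ (j + 2)) + q (i + 2) (m + 2) * X $ (m + 2) +
      q (i + 2) (m + 3) * X $ (m + 3))) = - quad S y"
    unfolding S_form sum_negf[symmetric]
  proof (intro sum.cong refl)
    fix i assume "i \<in> {0..<m}"
    then have i: "i < m" by simp
    have "(\<Sum>j = 0..<m. q (i + 2) (j + 2) * X $ (j + 2)) =
        (\<Sum>j = 0..<m. - (of_int (S $$ (i, j)) * y $ j))"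
      by (intro sum.cong refl) (simp only: atLeastLessThan_iff q(25)[OF i] X(6) mult_minus_left)
    then show "X $ (i + 2) * (q (i + 2) 0 * X $ 0 + q (i + 2) 1 * X $ 1 +
        (\<Sum>j = 0..<m. q (i + 2) (j + 2) * X $ (j + 2)) + q (i + 2) (m + 2) * X $ (m + 2) +
        q (i + 2) (m + 3) * X $ (m + 3)) =
        - (y $ i * (\<Sum>j = 0..<m. of_int (S $$ (i, j)) * y $ j))"
      by (simp only: q(21-24)[OF i] X(6)[OF i] sum_negf) simp
  qed
  have "quad (Qmat S) X = 2 * x1 * x4 + 2 * x2 * x3 - quad S y"
    unfolding expand split inner
    by (simp only: outer[of 0] outer[of 1] outer[of "m + 2"] outer[of "m + 3"] insert_iff simp_thms
        q(1-16) X(1,2,4,5)) (simp add: algebra_simps)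
  then show ?thesis by (simp add: X_def)
qed

definition qform :: "int mat \<Rightarrow> real Matrix.vec \<Rightarrow> real" where
  "qform S x = quad (Qmat S) x / 2"

definition lattice_L :: "int mat \<Rightarrow> real Matrix.vec set" where
  "lattice_L S = {x \<in> carrier_vec (dim_row S + 4). \<forall>i < dim_row S + 4. x $ i \<in> \<int>}"

text \<open>\<open>Q\<^sup>-\<^sup>1 L\<close>, written as a preimage.\<close>

definition dual_lattice :: "int mat \<Rightarrow> real Matrix.vec set" where
  "dual_lattice S =
    {x \<in> carrier_vec (dim_row S + 4). map_mat of_int (Qmat S) *\<^sub>v x \<in> lattice_L S}"

text \<open>The elements of \<open>L\<^sup>*/L\<close> are the cosets themselves, as sets of vectors; so \<open>\<lambda> \<in> \<alpha> + L\<close>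
  is \<open>\<lambda> \<in> \<alpha>\<close>.\<close>

definition discriminant_group :: "int mat \<Rightarrow> real Matrix.vec set set" where
  "discriminant_group S =
    dual_lattice S // {(x, y) \<in> dual_lattice S \<times> dual_lattice S. x - y \<in> lattice_L S}"

definition Q1 :: "int mat \<Rightarrow> 'a::comm_ring_1 triple \<Rightarrow> 'a" where
  "Q1 S = (\<lambda>(z, w, z'). 2 * z * z' - quad S w)"

definition Im_triple :: "complex triple \<Rightarrow> real triple" where
  "Im_triple = (\<lambda>(z, w, z'). (Im z, map_vec Im w, Im z'))"

definition domain_D :: "int mat \<Rightarrow> complex triple set" where
  "domain_D S = {(z, w, z'). Im z > 0 \<and> w \<in> carrier_vec (dim_row S) \<and> Im z' > 0 \<and>
    Q1 S (Im_triple (z, w, z')) > 0}"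

definition Ztilde :: "int mat \<Rightarrow> complex triple \<Rightarrow> complex Matrix.vec" where
  "Ztilde S = (\<lambda>(z, w, z').
    vec_of_list [- Q1 S (z, w, z') / 2, z] @\<^sub>v w @\<^sub>v vec_of_list [z', 1])"

definition Q_Ztilde :: "int mat \<Rightarrow> real Matrix.vec \<Rightarrow> complex triple \<Rightarrow> complex" where
  "Q_Ztilde S l Z = bilin (Qmat S) (map_vec complex_of_real l) (Ztilde S Z)"

definition q_lambda_Z :: "int mat \<Rightarrow> real Matrix.vec \<Rightarrow> complex triple \<Rightarrow> real" where
  "q_lambda_Z S l Z = (cmod (Q_Ztilde S l Z))\<^sup>2 / (2 * Q1 S (Im_triple Z))"

definition heegner :: "int mat \<Rightarrow> real Matrix.vec set \<Rightarrow> real \<Rightarrow> complex triple set" where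
  "heegner S \<alpha> n = (\<Union>l \<in> {l \<in> \<alpha>. qform S l = n}. {Z \<in> domain_D S. Q_Ztilde S l Z = 0})"

definition kappa :: "int mat \<Rightarrow> real" where
  "kappa S = (real (dim_row S) + 4) / 2"

definition hypergeom :: "complex \<Rightarrow> complex \<Rightarrow> complex \<Rightarrow> complex \<Rightarrow> complex" where
  "hypergeom a b c z =
    (\<Sum>k. pochhammer a k * pochhammer b k / pochhammer c k * (z ^ k / fact k))"

text \<open>Outside the Heegner divisor and for \<open>n < 0\<close> one has \<open>q_lambda_Z S l Z > 0\<close>, so the
  argument of the power and of the hypergeometric series lies in the real interval \<open>(0, 1)\<close>.\<close>

definition Phi ::
  "int mat \<Rightarrow> real Matrix.vec set \<Rightarrow> real \<Rightarrow> complex triple \<Rightarrow> complex \<Rightarrow> complex" where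
  "Phi S \<alpha> n Z s = (let k = complex_of_real (kappa S) in
    2 * (Gamma (s + k / 2 - 1) / Gamma (2 * s)) *
    (\<Sum>\<^sub>\<infinity>l \<in> {l \<in> \<alpha>. qform S l = n}.
       let u = complex_of_real (n / (n - q_lambda_Z S l Z)) in
         u powr (s + k / 2 - 1) * hypergeom (s + k / 2 - 1) (s - k / 2 + 1) (2 * s) u))"

definition hecke_reps :: "nat \<Rightarrow> (int \<times> int \<times> int) set" where
  "hecke_reps N = {(a, b, d). a > 0 \<and> d > 0 \<and> a * d = int N \<and> 0 \<le> b \<and> b < d}"

definition act_first :: "nat \<Rightarrow> int \<times> int \<times> int \<Rightarrow> complex triple \<Rightarrow> complex triple" where
  "act_first N = (\<lambda>(a, b, d) (z, w, z').
    ((of_int a * z + of_int b) / of_int d,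
     complex_of_real (sqrt (real N) / of_int d) \<cdot>\<^sub>v w,
     z'))"

definition act_last :: "nat \<Rightarrow> int \<times> int \<times> int \<Rightarrow> complex triple \<Rightarrow> complex triple" where
  "act_last N = (\<lambda>(a, b, d) (z, w, z').
    (z,
     complex_of_real (sqrt (real N) / of_int d) \<cdot>\<^sub>v w,
     (of_int a * z' + of_int b) / of_int d))"

end

theory Submission
  imports Defs "HOL-Library.Landau_Symbols" "Jordan_Normal_Form.Determinant"
begin

text \<open>A vector \<open>\<lambda> \<in> \<alpha>\<close> consists of an integral \<open>2 \<times> 2\<close> matrix \<open>X\<close> and a vector \<open>u\<close> from a coset of
  \<open>\<int>\<^sup>m\<close>. Acting on \<open>z\<close> by \<open>A = [[a, b], [0, d]]\<close> replaces \<open>X\<close> by \<open>A\<^sup>T X\<close>, acting on \<open>z'\<close> replaces it by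
  \<open>X A\<close>, and both scale \<open>u\<close> by \<open>\<surd>N\<close>. So the two double sums agree once every integral matrix \<open>Y\<close>
  is equally often of the form \<open>A\<^sup>T X\<close> and of the form \<open>X A\<close>, i.e. once the sublattices of index \<open>N\<close>
  containing the columns of \<open>Y\<close> are as many as those containing its rows. This number is invariant
  under unimodular row and column operations, and these carry \<open>Y\<close> to a symmetric matrix.

  To rearrange the infinite sums it suffices that they are either all summable or all not
  summable: on \<open>q(\<lambda>) = n\<close> the quantity \<open>q(\<lambda>\<^sub>Z) - n\<close> is comparable, uniformly in \<open>\<lambda>\<close>, to a positive
  definite form in \<open>\<lambda>\<close> independent of \<open>Z\<close>, and the hypergeometric factor tends to \<open>1\<close>.\<close>

section \<open>Sublattices of index N\<close>

text \<open>For \<open>A = [[a, b], [0, d]]\<close> this is the row lattice \<open>\<int>\<^sup>2 A\<close>. As \<open>A\<close> ranges over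
  \<open>hecke_reps N\<close>, these are all sublattices of \<open>\<int>\<^sup>2\<close> of index \<open>N\<close>, each occurring once.\<close>

definition hecke_lattice :: "int \<times> int \<times> int \<Rightarrow> (int \<times> int) set" where
  "hecke_lattice = (\<lambda>(a, b, d). {(a * x, b * x + d * y) | x y. True})"

lemma mem_hecke_lattice:
  "(p, q) \<in> hecke_lattice (a, b, d) \<longleftrightarrow> (\<exists>x y. p = a * x \<and> q = b * x + d * y)"
  by (auto simp: hecke_lattice_def)

lemma hecke_latticeI: "p = a * x \<Longrightarrow> q = b * x + d * y \<Longrightarrow> (p, q) \<in> hecke_lattice (a, b, d)"
  by (auto simp: hecke_lattice_def)

lemma finite_hecke_reps: "N > 0 \<Longrightarrow> finite (hecke_reps N)"
proof -
  assume N: "N > 0"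
  have "a \<le> int N \<and> d \<le> int N" if "a > 0" "d > 0" "a * d = int N" for a d :: int
    using that mult_left_mono[of 1 d a] mult_right_mono[of 1 a d] by auto
  then have "hecke_reps N \<subseteq> {0..int N} \<times> {0..int N} \<times> {0..int N}"
    unfolding hecke_reps_def by fastforce
  then show ?thesis by (rule finite_subset) simp
qed

text \<open>The basis \<open>(a, b)\<close>, \<open>(0, d)\<close> is a Hermite normal form: the
  vectors with first coordinate 0 determine \<open>d\<close>, then \<open>a * d = N\<close> gives
  \<open>a\<close>, and the vectors with first coordinate \<open>a\<close> fix \<open>b\<close>
  modulo \<open>d\<close>.\<close>

lemma inj_on_hecke_lattice: "inj_on hecke_lattice (hecke_reps N)"
proof (rule inj_onI)
  fix A A' assume "A \<in> hecke_reps N" "A' \<in> hecke_reps N" and eq: "hecke_lattice A = hecke_lattice A'"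
  then obtain a b d a' b' d' where A: "A = (a, b, d)" "A' = (a', b', d')"
    and pos: "a > 0" "d > 0" "a * d = int N" "0 \<le> b" "b < d" "a' > 0" "d' > 0" "a' * d' = int N"
      "0 \<le> b'" "b' < d'"
    by (auto simp: hecke_reps_def)
  have "(0, d) \<in> hecke_lattice (a, b, d)" "(0, d') \<in> hecke_lattice (a', b', d')"
    by (rule hecke_latticeI[where x = 0 and y = 1]; simp)+
  then have "(0, d) \<in> hecke_lattice (a', b', d')" "(0, d') \<in> hecke_lattice (a, b, d)"
    using eq unfolding A by simp_all
  moreover have "c dvd y" if y: "(0, y) \<in> hecke_lattice (a, b, c)" and "a > 0" for a b c y
  proof -
    from y obtain x t where "0 = a * x" "y = b * x + c * t" by (auto simp only: mem_hecke_lattice)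
    with \<open>a > 0\<close> show ?thesis by simp
  qed
  ultimately have "d' dvd d" "d dvd d'" using pos by blast+
  then have d: "d' = d" using pos by (intro zdvd_antisym_nonneg) simp_all
  have "a' * d = a * d" using pos(3,8) unfolding d by (simp only:)
  then have a: "a' = a" using pos(2) mult_right_cancel[of d a' a] by blast
  have "(a, b) \<in> hecke_lattice (a, b, d)"
    by (rule hecke_latticeI[where x = 1 and y = 0]; simp)
  then obtain y where "b = b' + d * y"
    using eq pos unfolding A a d by (auto simp: mem_hecke_lattice)
  then have "b mod d = b' mod d" by simp
  then have "b = b'" using pos d by simp
  then show "A = A'" using A a d by simp
qed

text \<open>Adding multiples of \<open>(0, d)\<close> to \<open>(a, b)\<close> keeps the lattice.
  This moves \<open>b\<close> into the range that \<open>hecke_reps\<close> requires.\<close>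

lemma hecke_lattice_mod: "hecke_lattice (a, b mod d, d) = hecke_lattice (a, b, d)"
proof -
  have *: "b * x = (b mod d) * x + d * ((b div d) * x)" for x
    by (metis distrib_right mod_mult_div_eq mult.assoc)
  have "(p, q) \<in> hecke_lattice (a, b mod d, d) \<longleftrightarrow> (p, q) \<in> hecke_lattice (a, b, d)" for p q
  proof
    assume "(p, q) \<in> hecke_lattice (a, b mod d, d)"
    then obtain x y where xy: "p = a * x" "q = (b mod d) * x + d * y" by (auto simp: mem_hecke_lattice)
    have "q = b * x + d * (y - (b div d) * x)"
      by (simp add: xy * right_diff_distrib)
    with xy show "(p, q) \<in> hecke_lattice (a, b, d)" unfolding mem_hecke_lattice by blast
  next
    assume "(p, q) \<in> hecke_lattice (a, b, d)"
    then obtain x y where xy: "p = a * x" "q = b * x + d * y" by (auto simp: mem_hecke_lattice)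
    have "q = (b mod d) * x + d * (y + (b div d) * x)"
      by (simp add: xy * distrib_left)
    with xy show "(p, q) \<in> hecke_lattice (a, b mod d, d)" unfolding mem_hecke_lattice by blast
  qed
  then show ?thesis by (auto simp: set_eq_iff)
qed

section \<open>Unimodular maps permuting the sublattices\<close>

definition shear :: "int \<Rightarrow> int \<times> int \<Rightarrow> int \<times> int" where
  "shear k = (\<lambda>(p, q). (p, q + k * p))"

text \<open>The basis goes to \<open>(a, b + k * a)\<close>, \<open>(0, d)\<close>, which is again
  triangular. Together with the swap, the shears generate GL_2(Z).\<close>

lemma shear_hecke_lattice:
  assumes "A \<in> hecke_reps N"
  shows "shear k ` hecke_lattice A \<in> hecke_lattice ` hecke_reps N"
proof -
  obtain a b d where A: "A = (a, b, d)" "a > 0" "d > 0" "a * d = int N"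
    using assms by (auto simp: hecke_reps_def)
  have "shear k ` hecke_lattice A = {(a * x, (b + k * a) * x + d * y) | x y. True}"
  proof -
    have "shear k (a * x, b * x + d * y) = (a * x, (b + k * a) * x + d * y)" for x y
      by (simp add: shear_def algebra_simps)
    moreover have "hecke_lattice A = (\<lambda>(x, y). (a * x, b * x + d * y)) ` UNIV"
      by (auto simp: A hecke_lattice_def)
    ultimately have "shear k ` hecke_lattice A = (\<lambda>(x, y). (a * x, (b + k * a) * x + d * y)) ` UNIV"
      by (simp only: image_image case_prod_unfold)
    then show ?thesis by auto
  qed
  also have "\<dots> = hecke_lattice (a, (b + k * a) mod d, d)"
    unfolding hecke_lattice_mod by (simp add: hecke_lattice_def)
  finally show ?thesis using A by (auto simp: hecke_reps_def)
qed

text \<open>The swapped basis \<open>(b, a)\<close>, \<open>(d, 0)\<close> is no longer triangular;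
  a Bezout identity for \<open>b\<close> and \<open>d\<close> supplies the new Hermite form.\<close>

lemma swap_hecke_lattice:
  assumes "A \<in> hecke_reps N"
  shows "prod.swap ` hecke_lattice A \<in> hecke_lattice ` hecke_reps N"
proof -
  obtain a b d where A: "A = (a, b, d)" "a > 0" "d > 0" "a * d = int N"
    using assms by (auto simp: hecke_reps_def)
  define g where "g = gcd b d"
  have g: "g > 0" using A by (simp add: g_def)
  obtain b1 where b1: "b = g * b1" unfolding g_def by (metis gcd_dvd1 dvdE)
  obtain d1 where d1: "d = g * d1" unfolding g_def by (metis gcd_dvd2 dvdE)
  have d1pos: "d1 > 0" using A g d1 by (simp add: zero_less_mult_iff)
  obtain x0 y0 where "x0 * b + y0 * d = g" unfolding g_def using bezout_int by blast
  then have "g * (x0 * b1 + y0 * d1) = g * 1" by (simp add: b1 d1 algebra_simps)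
  then have bz: "x0 * b1 + y0 * d1 = 1" using g by simp
  \<comment> \<open>The unimodular matrix with rows \<open>(x0, y0)\<close>,
    \<open>(d1, - b1)\<close> turns the rows \<open>(b, a)\<close>, \<open>(d, 0)\<close> into
    \<open>(g, a * x0)\<close>, \<open>(0, a * d1)\<close>.\<close>
  have "prod.swap ` hecke_lattice A = hecke_lattice (g, a * x0, a * d1)"
  proof -
    have "(p, q) \<in> prod.swap ` hecke_lattice A \<longleftrightarrow> (p, q) \<in> hecke_lattice (g, a * x0, a * d1)" for p q
    proof
      assume "(p, q) \<in> prod.swap ` hecke_lattice A"
      then obtain x y where xy: "p = b * x + d * y" "q = a * x"
        by (auto simp: A hecke_lattice_def)
      have "p = g * (b1 * x + d1 * y)" by (simp add: xy b1 d1 algebra_simps)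
      moreover have "q = a * x0 * (b1 * x + d1 * y) + a * d1 * (y0 * x - x0 * y)"
      proof -
        have "a * x0 * (b1 * x + d1 * y) + a * d1 * (y0 * x - x0 * y) = a * x * (x0 * b1 + y0 * d1)"
          by (simp add: algebra_simps)
        then show ?thesis by (simp add: bz xy)
      qed
      ultimately show "(p, q) \<in> hecke_lattice (g, a * x0, a * d1)"
        unfolding mem_hecke_lattice by blast
    next
      assume "(p, q) \<in> hecke_lattice (g, a * x0, a * d1)"
      then obtain t s where ts: "p = g * t" "q = a * x0 * t + a * d1 * s"
        by (auto simp: mem_hecke_lattice)
      have "b * (x0 * t + d1 * s) + d * (y0 * t - b1 * s) = g * t * (x0 * b1 + y0 * d1)"
        by (simp add: b1 d1 algebra_simps)
      then have "p = b * (x0 * t + d1 * s) + d * (y0 * t - b1 * s)" by (simp add: bz ts)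
      moreover have "q = a * (x0 * t + d1 * s)" by (simp add: ts algebra_simps)
      ultimately have "(q, p) \<in> hecke_lattice A" unfolding A mem_hecke_lattice by blast
      then show "(p, q) \<in> prod.swap ` hecke_lattice A" by force
    qed
    then show ?thesis by (auto simp: set_eq_iff simp del: mem_Collect_eq)
  qed
  also have "\<dots> = hecke_lattice (g, (a * x0) mod (a * d1), a * d1)"
    by (rule hecke_lattice_mod[symmetric])
  finally have "prod.swap ` hecke_lattice A = hecke_lattice (g, (a * x0) mod (a * d1), a * d1)" .
  moreover have "(g, (a * x0) mod (a * d1), a * d1) \<in> hecke_reps N"
  proof -
    have pos: "0 < a * d1" using A d1pos by simp
    have "g * (a * d1) = int N" using A d1 by (simp add: ac_simps)
    then show ?thesis
      using g pos pos_mod_sign[OF pos] pos_mod_bound[OF pos]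
      unfolding hecke_reps_def mem_Collect_eq case_prod_conv by (intro conjI)
  qed
  ultimately show ?thesis by blast
qed

section \<open>Lattices containing two given vectors\<close>

definition lattice_count :: "nat \<Rightarrow> int \<times> int \<Rightarrow> int \<times> int \<Rightarrow> nat" where
  "lattice_count N v w = card {A \<in> hecke_reps N. v \<in> hecke_lattice A \<and> w \<in> hecke_lattice A}"

text \<open>Passes from triples to lattices by injectivity, because shears and the swap act on the
  lattices and only indirectly on the triples.\<close>

lemma lattice_count_eq:
  "lattice_count N v w = card {L \<in> hecke_lattice ` hecke_reps N. v \<in> L \<and> w \<in> L}"
proof -
  have "{L \<in> hecke_lattice ` hecke_reps N. v \<in> L \<and> w \<in> L} =
    hecke_lattice ` {A \<in> hecke_reps N. v \<in> hecke_lattice A \<and> w \<in> hecke_lattice A}"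
    by auto
  then show ?thesis
    unfolding lattice_count_def
    by (metis (no_types, lifting) card_image inj_on_hecke_lattice inj_on_subset mem_Collect_eq subsetI)
qed

lemma lattice_count_bij:
  assumes N: "N > 0" and fg: "\<And>v. g (f v) = v" "\<And>v. f (g v) = v"
    and f: "\<And>A. A \<in> hecke_reps N \<Longrightarrow> f ` hecke_lattice A \<in> hecke_lattice ` hecke_reps N"
    and g: "\<And>A. A \<in> hecke_reps N \<Longrightarrow> g ` hecke_lattice A \<in> hecke_lattice ` hecke_reps N"
  shows "lattice_count N (f v) (f w) = lattice_count N v w"
  unfolding lattice_count_eq
proof (rule sym, rule bij_betw_same_card, rule bij_betw_byWitness[where f = "image f" and f' = "image g"])
  have mem: "f x \<in> L \<longleftrightarrow> x \<in> g ` L" "g x \<in> L \<longleftrightarrow> x \<in> f ` L" for x L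
    using fg by (metis image_eqI imageE)+
  show "image f ` {L \<in> hecke_lattice ` hecke_reps N. v \<in> L \<and> w \<in> L} \<subseteq>
      {L \<in> hecke_lattice ` hecke_reps N. f v \<in> L \<and> f w \<in> L}"
    using f by auto
  show "image g ` {L \<in> hecke_lattice ` hecke_reps N. f v \<in> L \<and> f w \<in> L} \<subseteq>
      {L \<in> hecke_lattice ` hecke_reps N. v \<in> L \<and> w \<in> L}"
    using g by (auto simp: mem)
qed (auto simp: image_image fg)

lemma lattice_count_shear: "N > 0 \<Longrightarrow> lattice_count N (shear k v) (shear k w) = lattice_count N v w"
  by (rule lattice_count_bij[where g = "shear (- k)"]) (auto simp: shear_hecke_lattice, auto simp: shear_def)

lemma lattice_count_swap:
  "N > 0 \<Longrightarrow> lattice_count N (prod.swap v) (prod.swap w) = lattice_count N v w"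
  by (rule lattice_count_bij[where g = prod.swap]) (auto simp: swap_hecke_lattice)

lemma lattice_count_commute: "lattice_count N v w = lattice_count N w v"
  unfolding lattice_count_def by (simp add: conj_commute)

text \<open>A lattice containing \<open>(p, q)\<close> is closed under adding its multiples, so both
  sides count the same lattices.\<close>

lemma lattice_count_combine:
  "lattice_count N (p, q) (r + k * p, s + k * q) = lattice_count N (p, q) (r, s)"
proof -
  have "(r + k * p, s + k * q) \<in> hecke_lattice A \<longleftrightarrow> (r, s) \<in> hecke_lattice A"
    if pq: "(p, q) \<in> hecke_lattice A" for A
  proof -
    obtain a b d where A: "A = (a, b, d)" by (cases A)
    obtain x y where xy: "p = a * x" "q = b * x + d * y" using pq by (auto simp: A mem_hecke_lattice)
    have *: "(p' + c * p, q' + c * q) \<in> hecke_lattice A" if m: "(p', q') \<in> hecke_lattice A" for p' q' c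
    proof -
      obtain x' y' where xy': "p' = a * x'" "q' = b * x' + d * y'"
        using m by (auto simp: A mem_hecke_lattice)
      have "p' + c * p = a * (x' + c * x)" "q' + c * q = b * (x' + c * x) + d * (y' + c * y)"
        by (simp_all add: xy xy' algebra_simps)
      then show ?thesis unfolding A mem_hecke_lattice by blast
    qed
    show ?thesis using *[of r s k] *[of "r + k * p" "s + k * q" "- k"] by (auto simp: algebra_simps)
  qed
  then have "(v \<in> hecke_lattice A \<and> w \<in> hecke_lattice A) = (v \<in> hecke_lattice A \<and> w' \<in> hecke_lattice A)"
    if "v = (p, q)" "w = (r + k * p, s + k * q)" "w' = (r, s)" for v w w' A
    using that by blast
  then show ?thesis unfolding lattice_count_def by simp
qed

text \<open>For the integer matrix \<open>[[p, q], [r, s]]\<close>: the number of lattices containing its columns equals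
  the number of those containing its rows.\<close>

definition transpose_ok :: "nat \<Rightarrow> int \<Rightarrow> int \<Rightarrow> int \<Rightarrow> int \<Rightarrow> bool" where
  "transpose_ok N p q r s \<longleftrightarrow> lattice_count N (p, r) (q, s) = lattice_count N (p, q) (r, s)"

lemma transpose_ok_transpose: "transpose_ok N p q r s \<longleftrightarrow> transpose_ok N p r q s"
  unfolding transpose_ok_def by auto

text \<open>On the column side the two vectors change places; on the row side the coordinates of
  both vectors do. Neither affects the count.\<close>

lemma transpose_ok_swap_cols:
  assumes "N > 0" shows "transpose_ok N q p s r \<longleftrightarrow> transpose_ok N p q r s"
  using lattice_count_swap[OF assms, of "(p, q)" "(r, s)"] lattice_count_commute[of N "(q, s)" "(p, r)"]
  unfolding transpose_ok_def by simp

text \<open>On the column side a multiple of one vector is added to the other; on the row side both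
  vectors are sheared.\<close>

lemma transpose_ok_shear_cols:
  assumes "N > 0" shows "transpose_ok N p (q + k * p) r (s + k * r) \<longleftrightarrow> transpose_ok N p q r s"
  using lattice_count_shear[OF assms, of k "(p, q)" "(r, s)"]
    lattice_count_combine[of N p r q k s]
  unfolding transpose_ok_def by (simp add: shear_def)

text \<open>Euclidean descent on \<open>\<bar>p\<bar>\<close>: if \<open>p\<close> divides \<open>r - q\<close>, a single shear makes the matrix symmetric;
  otherwise \<open>p\<close> fails to divide \<open>q\<close> or \<open>r\<close>, and a shear followed by a swap lowers \<open>\<bar>p\<bar>\<close>.\<close>

lemma transpose_ok_nonzero:
  assumes N: "N > 0" and "p \<noteq> 0"
  shows "transpose_ok N p q r s"
  using \<open>p \<noteq> 0\<close>
proof (induction "nat \<bar>p\<bar>" arbitrary: p q r s rule: less_induct)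
  case (less p q r s)
  have col: "transpose_ok N p q r s" if "\<not> p dvd q" for q r s
  proof -
    have "q mod p \<noteq> 0" using that by (simp add: dvd_eq_mod_eq_0)
    moreover have "nat \<bar>q mod p\<bar> < nat \<bar>p\<bar>" using less.prems abs_mod_less[of p q] by linarith
    ultimately have "transpose_ok N (q mod p) p (s + (- (q div p)) * r) r" by (rule less.hyps[rotated])
    then have "transpose_ok N p (q + (- (q div p)) * p) r (s + (- (q div p)) * r)"
      using transpose_ok_swap_cols[OF N] by (simp add: minus_div_mult_eq_mod)
    then show ?thesis using transpose_ok_shear_cols[OF N] by blast
  qed
  consider "\<not> p dvd q" | "\<not> p dvd r" | "p dvd r - q" using dvd_diff by blast
  then show ?case
  proof cases
    case 2
    then show ?thesis by (subst transpose_ok_transpose) (rule col)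
  next
    case 3
    then obtain k where k: "r - q = p * k" by (rule dvdE)
    have r: "q + k * p = r" using k by (simp add: mult.commute)
    have "transpose_ok N p (q + k * p) r (s + k * r)" unfolding r by (simp add: transpose_ok_def)
    then show ?thesis by (rule transpose_ok_shear_cols[OF N, THEN iffD1])
  qed (rule col)
qed

lemma lattice_count_transpose:
  assumes N: "N > 0"
  shows "lattice_count N (p, r) (q, s) = lattice_count N (p, q) (r, s)"
proof -
  have "transpose_ok N p q r s"
  \<comment> \<open>If all three entries vanish, the matrix is symmetric already. Otherwise
    transposition and an exchange of columns bring a non-zero one to the top left corner.\<close>
  proof (cases "p = 0 \<and> q = 0 \<and> r = 0")
    case True then show ?thesis by (simp add: transpose_ok_def)
  next
    case False
    then show ?thesis
      using transpose_ok_nonzero[OF N] transpose_ok_swap_cols[OF N] transpose_ok_transpose by blast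
  qed
  then show ?thesis by (simp add: transpose_ok_def)
qed

section \<open>Quadratic forms\<close>

lemma bilin_sum:
  assumes "S \<in> carrier_mat m m" "x \<in> carrier_vec m" "y \<in> carrier_vec m"
  shows "bilin S x y = (\<Sum>i<m. \<Sum>j<m. of_int (S $$ (i, j)) * (x $ i * y $ j))"
  using assms
  by (auto simp: bilin_def scalar_prod_def sum_distrib_left atLeast0LessThan ac_simps intro!: sum.cong)

lemma bilin_commute:
  assumes S: "S \<in> carrier_mat m m" "sym_mat S" and xy: "x \<in> carrier_vec m" "y \<in> carrier_vec m"
  shows "bilin S x y = bilin S y x"
proof -
  have "S $$ (i, j) = S $$ (j, i)" if "i < m" "j < m" for i j
    using S that unfolding sym_mat_def by (metis carrier_matD index_transpose_mat(1))
  then show ?thesis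
    unfolding bilin_sum[OF S(1) xy] bilin_sum[OF S(1) xy(2,1)]
    by (subst sum.swap) (auto intro!: sum.cong simp: ac_simps)
qed

lemma bilin_add_left:
  assumes "S \<in> carrier_mat m m" "x \<in> carrier_vec m" "x' \<in> carrier_vec m" "y \<in> carrier_vec m"
  shows "bilin S (x + x') y = bilin S x y + bilin S x' y"
  using assms by (simp add: bilin_sum[of _ m] algebra_simps sum.distrib)

lemma bilin_add_right:
  assumes "S \<in> carrier_mat m m" "x \<in> carrier_vec m" "y \<in> carrier_vec m" "y' \<in> carrier_vec m"
  shows "bilin S x (y + y') = bilin S x y + bilin S x y'"
  using assms by (simp add: bilin_sum[of _ m] algebra_simps sum.distrib)

lemma bilin_smult_left:
  assumes "S \<in> carrier_mat m m" "x \<in> carrier_vec m" "y \<in> carrier_vec m"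
  shows "bilin S (c \<cdot>\<^sub>v x) y = c * bilin S x y"
  using assms by (simp add: bilin_sum[of _ m] sum_distrib_left ac_simps)

lemma bilin_smult_right:
  assumes "S \<in> carrier_mat m m" "x \<in> carrier_vec m" "y \<in> carrier_vec m"
  shows "bilin S x (c \<cdot>\<^sub>v y) = c * bilin S x y"
  using assms by (simp add: bilin_sum[of _ m] sum_distrib_left ac_simps)

lemma quad_smult:
  assumes "S \<in> carrier_mat m m" "x \<in> carrier_vec m"
  shows "quad S (c \<cdot>\<^sub>v x) = c\<^sup>2 * quad S x"
  using assms by (simp add: quad_def bilin_smult_left[of _ m] bilin_smult_right[of _ m] power2_eq_square)

lemma quad_add:
  assumes "S \<in> carrier_mat m m" "sym_mat S" "x \<in> carrier_vec m" "y \<in> carrier_vec m"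
  shows "quad S (x + y) = quad S x + 2 * bilin S x y + quad S y"
  using assms bilin_commute[of S m x y]
  by (simp add: quad_def bilin_add_left[of _ m] bilin_add_right[of _ m] algebra_simps)

lemma bilin_of_real:
  assumes "S \<in> carrier_mat m m" "u \<in> carrier_vec m" "w \<in> carrier_vec m"
  shows "Re (bilin S (map_vec complex_of_real u) w) = bilin S u (map_vec Re w)"
    "Im (bilin S (map_vec complex_of_real u) w) = bilin S u (map_vec Im w)"
  using assms by (simp_all add: bilin_sum[of _ m] Re_sum Im_sum)

lemma quad_complex:
  assumes S: "S \<in> carrier_mat m m" "sym_mat S" and w: "w \<in> carrier_vec m"
  shows "Re (quad S w) = quad S (map_vec Re w) - quad S (map_vec Im w)"
    "Im (quad S w) = 2 * bilin S (map_vec Re w) (map_vec Im w)"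
proof -
  have w': "map_vec Re w \<in> carrier_vec m" "map_vec Im w \<in> carrier_vec m" using w by auto
  show "Re (quad S w) = quad S (map_vec Re w) - quad S (map_vec Im w)"
    using S w by (simp add: quad_def bilin_sum[of _ m] Re_sum right_diff_distrib sum_subtractf)
  have "Im (quad S w) = bilin S (map_vec Re w) (map_vec Im w) + bilin S (map_vec Im w) (map_vec Re w)"
    using S w by (simp add: quad_def bilin_sum[of _ m] Im_sum distrib_left sum.distrib)
  then show "Im (quad S w) = 2 * bilin S (map_vec Re w) (map_vec Im w)"
    using bilin_commute[OF S w'] by simp
qed

section \<open>Cauchy-Schwarz and coordinate bounds for a positive definite form\<close>

locale posdef_form =
  fixes m :: nat and S :: "int mat"
  assumes S: "S \<in> carrier_mat m m" and sym: "sym_mat S" and pos_def: "pos_def_mat S"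
begin

lemma quad_pos:
  fixes x :: "real Matrix.vec"
  shows "x \<in> carrier_vec m \<Longrightarrow> x \<noteq> 0\<^sub>v m \<Longrightarrow> quad S x > 0"
  using pos_def S unfolding pos_def_mat_def by auto

lemma quad_nonneg:
  fixes x :: "real Matrix.vec"
  assumes x: "x \<in> carrier_vec m"
  shows "quad S x \<ge> 0"
proof (cases "x = 0\<^sub>v m")
  case True
  then show ?thesis using S by (simp add: quad_def bilin_sum[of _ m])
qed (use quad_pos[OF x] in auto)

lemma Cauchy_Schwarz_bilin:
  fixes x y :: "real Matrix.vec"
  assumes x: "x \<in> carrier_vec m" and y: "y \<in> carrier_vec m"
  shows "(bilin S x y)\<^sup>2 \<le> quad S x * quad S y"
proof (cases "y = 0\<^sub>v m")
  case True
  then show ?thesis using S x by (simp add: quad_def bilin_sum[of _ m])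
next
  case False
  then have pos: "quad S y > 0" using quad_pos y by blast
  \<comment> \<open>This value minimises \<open>quad S (x + t \<cdot>\<^sub>v y)\<close>.\<close>
  define t where "t = - bilin S x y / quad S y"
  have "0 \<le> quad S (x + t \<cdot>\<^sub>v y)" using x y by (intro quad_nonneg) simp
  also have "\<dots> = quad S x - (bilin S x y)\<^sup>2 / quad S y"
    using S sym x y pos
    by (simp add: quad_add[of _ m] quad_smult[of _ m] bilin_smult_right[of _ m] t_def power2_eq_square)
  finally show ?thesis using pos by (simp add: field_simps)
qed

lemma abs_bilin_le:
  fixes x y :: "real Matrix.vec"
  assumes "x \<in> carrier_vec m" "y \<in> carrier_vec m"
  shows "\<bar>bilin S x y\<bar> \<le> sqrt (quad S x) * sqrt (quad S y)"
  using Cauchy_Schwarz_bilin[OF assms] by (metis real_le_rsqrt real_sqrt_abs real_sqrt_le_iff real_sqrt_mult)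

lemma sqrt_quad_triangle:
  fixes x y :: "real Matrix.vec"
  assumes x: "x \<in> carrier_vec m" and y: "y \<in> carrier_vec m"
  shows "sqrt (quad S (x + y)) \<le> sqrt (quad S x) + sqrt (quad S y)"
proof (rule real_le_lsqrt)
  show "quad S (x + y) \<le> (sqrt (quad S x) + sqrt (quad S y))\<^sup>2"
    using abs_bilin_le[OF x y] quad_nonneg[OF x] quad_nonneg[OF y]
    by (simp add: quad_add[OF S sym x y] power2_sum)
qed (use x y quad_nonneg in auto)

text \<open>Each coordinate is the product under \<open>S\<close> with a column of the inverse of
  \<open>S\<close>, so Cauchy-Schwarz applies; summing over the columns makes the constant
  uniform.\<close>

lemma coordinate_bound:
  obtains C where "\<And>(x :: real Matrix.vec) i. x \<in> carrier_vec m \<Longrightarrow> i < m \<Longrightarrow> (x $ i)\<^sup>2 \<le> C * quad S x"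
proof -
  let ?S = "map_mat real_of_int S"
  have cS: "?S \<in> carrier_mat m m" using S by simp
  have "det ?S \<noteq> 0"
  proof
    assume "det ?S = 0"
    then obtain v where v: "v \<in> carrier_vec m" "v \<noteq> 0\<^sub>v m" "?S *\<^sub>v v = 0\<^sub>v m"
      using det_0_iff_vec_prod_zero[OF cS] by blast
    then have "quad S v = 0" by (simp add: quad_def bilin_def)
    then show False using quad_pos v by force
  qed
  then obtain T where T: "T \<in> carrier_mat m m" "?S * T = 1\<^sub>m m"
    using det_non_zero_imp_unit[OF cS] unfolding Units_def ring_mat_def by auto
  define f where "f i = T *\<^sub>v unit_vec m i" for i
  have f: "f i \<in> carrier_vec m" for i using T by (simp add: f_def)
  have Sf: "bilin S x (f i) = x $ i" if "x \<in> carrier_vec m" "i < m" for x i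
  proof -
    have "?S *\<^sub>v f i = (?S * T) *\<^sub>v unit_vec m i"
      unfolding f_def by (rule assoc_mult_mat_vec[symmetric, OF cS T(1)]) simp
    then have "?S *\<^sub>v f i = unit_vec m i" unfolding T(2) by simp
    then show ?thesis using that by (simp add: bilin_def)
  qed
  define C where "C = (\<Sum>i<m. quad S (f i))"
  have "(x $ i)\<^sup>2 \<le> C * quad S x" if x: "x \<in> carrier_vec m" "i < m" for x i
  proof -
    have "quad S (f i) \<le> C" unfolding C_def
      using x f by (intro member_le_sum) (auto intro: quad_nonneg)
    then have "quad S x * quad S (f i) \<le> quad S x * C"
      by (rule mult_left_mono) (rule quad_nonneg[OF x(1)])
    then show ?thesis
      using Cauchy_Schwarz_bilin[OF x(1) f, of i] Sf[OF x] by (simp add: mult.commute)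
  qed
  then show ?thesis by (rule that)
qed

end

section \<open>Finiteness of bounded parts of a coset\<close>

lemma finite_vec_set:
  assumes "\<And>i. i < k \<Longrightarrow> finite (F i)"
  shows "finite {x \<in> carrier_vec k. \<forall>i<k. x $ i \<in> F i}"
proof (rule finite_subset)
  show "{x \<in> carrier_vec k. \<forall>i<k. x $ i \<in> F i} \<subseteq> vec k ` PiE {..<k} F"
  proof
    fix x assume x: "x \<in> {x \<in> carrier_vec k. \<forall>i<k. x $ i \<in> F i}"
    then have "x = vec k (restrict (($) x) {..<k})" by auto
    moreover have "restrict (($) x) {..<k} \<in> PiE {..<k} F" using x by auto
    ultimately show "x \<in> vec k ` PiE {..<k} F" by blast
  qed
  show "finite (vec k ` PiE {..<k} F)" using assms by (intro finite_imageI finite_PiE) auto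
qed

lemma finite_bounded_int_coset: "finite {r :: real. r - c \<in> \<int> \<and> \<bar>r\<bar> \<le> B}"
proof (rule finite_subset)
  show "{r. r - c \<in> \<int> \<and> \<bar>r\<bar> \<le> B} \<subseteq> (\<lambda>k. c + of_int k) ` {\<lceil>- B - c\<rceil>..\<lfloor>B - c\<rfloor>}"
  proof
    fix r assume r: "r \<in> {r. r - c \<in> \<int> \<and> \<bar>r\<bar> \<le> B}"
    then obtain k where k: "r - c = of_int k" by (auto elim: Ints_cases)
    then have "k \<in> {\<lceil>- B - c\<rceil>..\<lfloor>B - c\<rfloor>}" using r by (auto simp: ceiling_le_iff le_floor_iff)
    moreover have "r = c + of_int k" using k by simp
    ultimately show "r \<in> (\<lambda>k. c + of_int k) ` {\<lceil>- B - c\<rceil>..\<lfloor>B - c\<rfloor>}" by blast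
  qed
qed simp

section \<open>Vectors in coordinates\<close>

lemma vec_ext_lvec:
  assumes "l \<in> carrier_vec (m + 4)" "l' \<in> carrier_vec (m + 4)"
    and "l $ 0 = l' $ 0" "l $ 1 = l' $ 1" "l $ (m + 2) = l' $ (m + 2)" "l $ (m + 3) = l' $ (m + 3)"
    and mid: "\<And>i. i < m \<Longrightarrow> l $ (i + 2) = l' $ (i + 2)"
  shows "l = l'"
proof (rule eq_vecI)
  fix i assume i: "i < dim_vec l'"
  consider "i = 0" | "i = 1" | "i = m + 2" | "i = m + 3" | j where "j < m" "i = j + 2"
    using i assms(2) by (cases i; cases "i - 1"; force)
  then show "l $ i = l' $ i" using assms by cases auto
qed (use assms in auto)

text \<open>An entrywise description of the concatenations in \<open>Ztilde\<close>. The form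
  \<open>Q\<close> pairs \<open>a\<close> with \<open>d\<close> and \<open>b\<close> with
  \<open>c\<close>, and is \<open>- S\<close> on \<open>u\<close>.\<close>

definition lvec :: "'a \<Rightarrow> 'a \<Rightarrow> 'a Matrix.vec \<Rightarrow> 'a \<Rightarrow> 'a \<Rightarrow> 'a Matrix.vec" where
  "lvec a b u c d = vec (dim_vec u + 4) (\<lambda>i. if i = 0 then a else if i = 1 then b
    else if i = dim_vec u + 2 then c else if i = dim_vec u + 3 then d else u $ (i - 2))"

lemma dim_lvec [simp]: "dim_vec (lvec a b u c d) = dim_vec u + 4"
  by (simp add: lvec_def)

lemma lvec_carrier [simp]: "lvec a b u c d \<in> carrier_vec (m + 4) \<longleftrightarrow> u \<in> carrier_vec m"
  by (simp only: carrier_vec_def mem_Collect_eq dim_lvec add_right_cancel)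

lemma lvec_index:
  assumes "u \<in> carrier_vec m"
  shows "lvec a b u c d $ 0 = a" "lvec a b u c d $ 1 = b" "lvec a b u c d $ (m + 2) = c"
    "lvec a b u c d $ (m + 3) = d" "\<And>i. i < m \<Longrightarrow> lvec a b u c d $ (i + 2) = u $ i"
  using assms by (auto simp: lvec_def)

lemma lvec_append: "vec_of_list [a, b] @\<^sub>v u @\<^sub>v vec_of_list [c, d] = lvec a b u c d" (is "?l = _")
proof -
  define l where "l = ?l"
  have "l $ 0 = a" "l $ 1 = b" "l $ (dim_vec u + 2) = c" "l $ (dim_vec u + 3) = d"
    "\<And>i. i < dim_vec u \<Longrightarrow> l $ (i + 2) = u $ i" "dim_vec l = dim_vec u + 4"
    by (auto simp: l_def append_vec_def vec_of_list_index Let_def)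
  then have "l = lvec a b u c d"
    by (intro vec_ext_lvec[where m = "dim_vec u"])
      (simp_all only: carrier_vec_def mem_Collect_eq dim_lvec lvec_index[OF carrier_vec_dim_vec])
  then show ?thesis by (simp only: l_def)
qed

definition mid :: "'a Matrix.vec \<Rightarrow> 'a Matrix.vec" where
  "mid l = vec (dim_vec l - 4) (\<lambda>i. l $ (i + 2))"

lemma mid_carrier [simp]: "l \<in> carrier_vec (m + 4) \<Longrightarrow> mid l \<in> carrier_vec m"
  by (auto simp: mid_def)

lemma mid_lvec [simp]: "mid (lvec a b u c d) = u"
  by (intro eq_vecI) (auto simp: mid_def lvec_def)

lemma lvec_eta:
  assumes l: "l \<in> carrier_vec (m + 4)"
  shows "lvec (l $ 0) (l $ 1) (mid l) (l $ (m + 2)) (l $ (m + 3)) = l"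
proof -
  have "mid l $ i = l $ (i + 2)" if "i < m" for i using l that by (simp add: mid_def)
  then show ?thesis
    using l by (intro vec_ext_lvec[where m = m]) (simp_all only: lvec_index[OF mid_carrier[OF l]] lvec_carrier mid_carrier)
qed

lemma lvec_add:
  assumes "u \<in> carrier_vec m" "u' \<in> carrier_vec m"
  shows "lvec a b u c d + lvec a' b' u' c' d' = lvec (a + a') (b + b') (u + u') (c + c') (d + d')"
  using assms by (intro eq_vecI) (auto simp: lvec_def)

lemma lvec_map: "map_vec f (lvec a b u c d) = lvec (f a) (f b) (map_vec f u) (f c) (f d)"
  by (intro eq_vecI) (auto simp: lvec_def)

section \<open>The form Q in coordinates\<close>

lemma Qmat_carrier: "S \<in> carrier_mat m m \<Longrightarrow> Qmat S \<in> carrier_mat (m + 4) (m + 4)"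
  by (auto simp: Qmat_def Let_def)

lemma sym_Qmat:
  assumes "S \<in> carrier_mat m m" "sym_mat S"
  shows "sym_mat (Qmat S)"
proof -
  have "S $$ (i, j) = S $$ (j, i)" if "i < m" "j < m" for i j
    using assms that unfolding sym_mat_def by (metis carrier_matD index_transpose_mat(1))
  then show ?thesis
    using assms(1) by (auto simp: sym_mat_def Qmat_def Let_def intro!: eq_matI)
qed

lemma quad_lvec:
  assumes "S \<in> carrier_mat m m" "u \<in> carrier_vec m"
  shows "quad (Qmat S) (lvec a b u c d) = 2 * a * d + 2 * b * c - quad S u"
  using quad_Qmat[OF assms, of a b c d] by (simp only: lvec_append)

text \<open>Obtained from \<open>quad_lvec\<close> by polarisation, hence a division by 2 in
  characteristic 0.\<close>

lemma bilin_lvec: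
  fixes a b c d :: "'a :: field_char_0"
  assumes S: "S \<in> carrier_mat m m" "sym_mat S" and u: "u \<in> carrier_vec m" "u' \<in> carrier_vec m"
  shows "bilin (Qmat S) (lvec a b u c d) (lvec a' b' u' c' d') =
    a * d' + b * c' + c * b' + d * a' - bilin S u u'"
proof -
  let ?x = "lvec a b u c d" and ?y = "lvec a' b' u' c' d'"
  have "2 * bilin (Qmat S) ?x ?y = quad (Qmat S) (?x + ?y) - quad (Qmat S) ?x - quad (Qmat S) ?y"
    using u by (subst quad_add[OF Qmat_carrier[OF S(1)] sym_Qmat[OF S]]) simp_all
  also have "\<dots> = 2 * (a * d' + b * c' + c * b' + d * a' - bilin S u u')"
    using u by (simp add: lvec_add[where m = m] quad_lvec[OF S(1)] quad_add[OF S] algebra_simps)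
  finally have "2 * (bilin (Qmat S) ?x ?y - (a * d' + b * c' + c * b' + d * a' - bilin S u u')) = 0"
    by (simp only: right_diff_distrib diff_self)
  then show ?thesis by (simp only: mult_eq_0_iff) simp
qed

lemma qform_lvec:
  assumes "S \<in> carrier_mat m m" "u \<in> carrier_vec m"
  shows "qform S (lvec a b u c d) = a * d + b * c - quad S u / 2"
  unfolding qform_def quad_lvec[OF assms] by (simp add: field_simps)

lemma Q_Ztilde_lvec:
  assumes S: "S \<in> carrier_mat m m" "sym_mat S" and u: "u \<in> carrier_vec m" "w \<in> carrier_vec m"
  shows "Q_Ztilde S (lvec a b u c d) (z, w, z') =
    a + b * z' + c * z - d * (z * z' - quad S w / 2) - bilin S (map_vec complex_of_real u) w"
proof -
  have "Q_Ztilde S (lvec a b u c d) (z, w, z') =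
      bilin (Qmat S) (lvec (of_real a) (of_real b) (map_vec of_real u) (of_real c) (of_real d))
        (lvec (- Q1 S (z, w, z') / 2) z w z' 1)"
    by (simp only: Q_Ztilde_def Ztilde_def lvec_map lvec_append case_prod_conv)
  also have "\<dots> = a + b * z' + c * z + d * (- Q1 S (z, w, z') / 2) - bilin S (map_vec complex_of_real u) w"
    using u by (subst bilin_lvec[OF S]) simp_all
  finally show ?thesis by (simp add: Q1_def algebra_simps diff_divide_distrib)
qed

text \<open>The positive definite form that serves as a yardstick for all \<open>Z\<close> at
  once.\<close>

definition height :: "int mat \<Rightarrow> real Matrix.vec \<Rightarrow> real" where
  "height S l = (l $ 0)\<^sup>2 + (l $ 1)\<^sup>2 + (l $ (dim_row S + 2))\<^sup>2 + (l $ (dim_row S + 3))\<^sup>2 + quad S (mid l)"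

text \<open>The reverse Cauchy-Schwarz inequality in signature \<open>(1, m + 1)\<close>. Here \<open>K = Im z \<cdot> Im z'\<close>,
  \<open>V = S[Im w]\<close>, \<open>U\<close> is the \<open>S\<close>-norm of the middle part of a vector, \<open>s\<close> its \<open>S\<close>-product with
  \<open>Im w\<close>, and \<open>B\<close> the Lorentz product with \<open>Im Z\<close>.\<close>

lemma lorentz_bound:
  fixes K V :: real
  assumes "K > 0" "0 \<le> V" "V < 2 * K"
  obtains \<delta> C where "\<delta> > 0" "C \<ge> 0"
    "\<And>B s U. U \<ge> 0 \<Longrightarrow> s\<^sup>2 \<le> U * V \<Longrightarrow> (B + s)\<^sup>2 / (4 * K) - U / 2 \<le> C * B\<^sup>2 - \<delta> * U"
proof -
  \<comment> \<open>\<open>\<theta> < 1\<close> expresses that \<open>Im Z\<close> lies inside the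
    positive cone; \<open>\<epsilon>\<close> is so small that
    \<open>(1 + \<epsilon>) * \<theta>\<close> stays below 1.\<close>
  define \<theta> where "\<theta> = V / (2 * K)"
  have \<theta>: "0 \<le> \<theta>" "\<theta> < 1" using assms by (simp_all add: \<theta>_def)
  define \<epsilon> where "\<epsilon> = (1 - \<theta>) / 2"
  have \<epsilon>: "\<epsilon> > 0" using \<theta> by (simp add: \<epsilon>_def)
  define \<delta> where "\<delta> = (1 - (1 + \<epsilon>) * \<theta>) / 2"
  have "1 - (1 + \<epsilon>) * \<theta> = (1 - \<theta>) * (1 - \<theta> / 2)" by (simp add: \<epsilon>_def field_simps)
  then have \<delta>: "\<delta> > 0" using \<theta> by (simp add: \<delta>_def)
  define C where "C = (1 + 1 / \<epsilon>) / (4 * K)"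
  have C: "C \<ge> 0" using \<epsilon> assms by (simp add: C_def)
  have "(B + s)\<^sup>2 / (4 * K) - U / 2 \<le> C * B\<^sup>2 - \<delta> * U" if U: "U \<ge> 0" "s\<^sup>2 \<le> U * V" for B s U
  proof -
    \<comment> \<open>A weighted Young inequality for the mixed term
      \<open>2 * B * s\<close>.\<close>
    have "0 \<le> (B - \<epsilon> * s)\<^sup>2 / \<epsilon>" using \<epsilon> by simp
    also have "\<dots> = (1 + 1 / \<epsilon>) * B\<^sup>2 + (1 + \<epsilon>) * s\<^sup>2 - (B + s)\<^sup>2"
      using \<epsilon> by (simp add: field_simps power2_eq_square)
    finally have "(B + s)\<^sup>2 \<le> (1 + 1 / \<epsilon>) * B\<^sup>2 + (1 + \<epsilon>) * s\<^sup>2" by simp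
    also have "(1 + \<epsilon>) * s\<^sup>2 \<le> (1 + \<epsilon>) * (U * V)" using U \<epsilon> by (intro mult_left_mono) auto
    finally have "(B + s)\<^sup>2 / (4 * K) \<le> ((1 + 1 / \<epsilon>) * B\<^sup>2 + (1 + \<epsilon>) * (U * V)) / (4 * K)"
      using assms by (intro divide_right_mono) auto
    also have "\<dots> = (1 + 1 / \<epsilon>) * B\<^sup>2 / (4 * K) + (1 + \<epsilon>) * (U * V) / (4 * K)"
      by (rule add_divide_distrib)
    also have "(1 + 1 / \<epsilon>) * B\<^sup>2 / (4 * K) = C * B\<^sup>2" by (simp add: C_def)
    also have "(1 + \<epsilon>) * (U * V) / (4 * K) = (1 + \<epsilon>) * \<theta> * U / 2" by (simp add: \<theta>_def)
    also have "(1 + \<epsilon>) * \<theta> * U / 2 = U / 2 - \<delta> * U"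
      by (simp add: \<delta>_def left_diff_distrib diff_divide_distrib)
    finally show ?thesis by simp
  qed
  with \<delta> C show ?thesis by (rule that)
qed

text \<open>Over a principal filter, \<open>O\<close> is a uniform bound on a set, which spares tracking constants.\<close>

lemma bigo_sqrtI:
  fixes f T :: "'a \<Rightarrow> real"
  assumes "c > 0" "\<And>x. x \<in> V \<Longrightarrow> c * (f x)\<^sup>2 \<le> C * T x" "\<And>x. x \<in> V \<Longrightarrow> T x \<ge> 0"
  shows "f \<in> O[principal V](\<lambda>x. sqrt (T x))"
proof (rule bigoI[of _ "sqrt (C / c)"])
  have "norm (f x) \<le> sqrt (C / c) * norm (sqrt (T x))" if x: "x \<in> V" for x
  proof -
    have "(f x)\<^sup>2 \<le> C / c * T x" using assms(1) assms(2)[OF x] by (simp add: field_simps)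
    then have "\<bar>f x\<bar> \<le> sqrt (C / c * T x)" by (metis real_sqrt_abs real_sqrt_le_iff)
    then show ?thesis using assms(3)[OF x] by (simp only: real_sqrt_mult real_norm_def abs_of_nonneg real_sqrt_ge_0_iff)
  qed
  then show "\<forall>\<^sub>F x in principal V. norm (f x) \<le> sqrt (C / c) * norm (sqrt (T x))"
    by (simp add: eventually_principal)
qed

lemma bigo_sqrt_squareD:
  fixes f T :: "'a \<Rightarrow> real"
  assumes "f \<in> O[principal V](\<lambda>x. sqrt (T x))" "\<And>x. x \<in> V \<Longrightarrow> T x \<ge> 0"
  obtains C where "C > 0" "\<And>x. x \<in> V \<Longrightarrow> (f x)\<^sup>2 \<le> C * T x"
proof -
  obtain c where c: "c > 0" "\<forall>x \<in> V. \<bar>f x\<bar> \<le> c * \<bar>sqrt (T x)\<bar>"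
    by (rule landau_o.bigE[OF assms(1)]) (simp add: eventually_principal)
  have "(f x)\<^sup>2 \<le> c\<^sup>2 * T x" if x: "x \<in> V" for x
    using power_mono[OF bspec[OF c(2) x], of 2] assms(2)[OF x] by (simp add: power_mult_distrib)
  moreover have "c\<^sup>2 > 0" using c(1) by simp
  ultimately show ?thesis using that by blast
qed

section \<open>Comparison of majorants\<close>

context posdef_form
begin

lemma height_eq:
  "height S l = (l $ 0)\<^sup>2 + (l $ 1)\<^sup>2 + (l $ (m + 2))\<^sup>2 + (l $ (m + 3))\<^sup>2 + quad S (mid l)"
  using S by (simp add: height_def)

lemma height_bounds:
  assumes l: "l \<in> carrier_vec (m + 4)"
  shows "(l $ 0)\<^sup>2 \<le> height S l" "(l $ 1)\<^sup>2 \<le> height S l" "(l $ (m + 2))\<^sup>2 \<le> height S l"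
    "(l $ (m + 3))\<^sup>2 \<le> height S l" "quad S (mid l) \<le> height S l"
  using quad_nonneg[OF mid_carrier[OF l]] unfolding height_eq by simp_all

lemma qform_carrier:
  assumes l: "l \<in> carrier_vec (m + 4)"
  shows "qform S l = l $ 0 * l $ (m + 3) + l $ 1 * l $ (m + 2) - quad S (mid l) / 2"
  by (subst (1) lvec_eta[OF l, symmetric]) (rule qform_lvec[OF S mid_carrier[OF l]])

lemma abs_qform_le_height:
  assumes l: "l \<in> carrier_vec (m + 4)"
  shows "\<bar>qform S l\<bar> \<le> height S l"
proof -
  have *: "2 * \<bar>x * y\<bar> \<le> x\<^sup>2 + y\<^sup>2" for x y :: real
    using sum_squares_bound[of "\<bar>x\<bar>" "\<bar>y\<bar>"] by (simp add: abs_mult)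
  show ?thesis
    using *[of "l $ 0" "l $ (m + 3)"] *[of "l $ 1" "l $ (m + 2)"] quad_nonneg[OF mid_carrier[OF l]]
    unfolding qform_carrier[OF l] height_eq by linarith
qed

lemma Q_Ztilde_Re_Im:
  assumes l: "l \<in> carrier_vec (m + 4)" and w: "w \<in> carrier_vec m"
  shows "Re (Q_Ztilde S l (z, w, z')) = l $ 0 + l $ 1 * Re z' + l $ (m + 2) * Re z
      - l $ (m + 3) * (Re z * Re z' - Im z * Im z' - (quad S (map_vec Re w) - quad S (map_vec Im w)) / 2)
      - bilin S (mid l) (map_vec Re w)"
    and "Im (Q_Ztilde S l (z, w, z')) = l $ 1 * Im z' + l $ (m + 2) * Im z
      - l $ (m + 3) * (Re z * Im z' + Im z * Re z' - bilin S (map_vec Re w) (map_vec Im w))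
      - bilin S (mid l) (map_vec Im w)"
proof -
  have eq: "Q_Ztilde S l (z, w, z') = l $ 0 + l $ 1 * z' + l $ (m + 2) * z
      - l $ (m + 3) * (z * z' - quad S w / 2) - bilin S (map_vec complex_of_real (mid l)) w"
    by (subst (1) lvec_eta[OF l, symmetric]) (rule Q_Ztilde_lvec[OF S sym mid_carrier[OF l] w])
  show "Re (Q_Ztilde S l (z, w, z')) = l $ 0 + l $ 1 * Re z' + l $ (m + 2) * Re z
      - l $ (m + 3) * (Re z * Re z' - Im z * Im z' - (quad S (map_vec Re w) - quad S (map_vec Im w)) / 2)
      - bilin S (mid l) (map_vec Re w)"
    unfolding eq by (simp add: bilin_of_real[OF S mid_carrier[OF l] w] quad_complex[OF S sym w])
  show "Im (Q_Ztilde S l (z, w, z')) = l $ 1 * Im z' + l $ (m + 2) * Im z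
      - l $ (m + 3) * (Re z * Im z' + Im z * Re z' - bilin S (map_vec Re w) (map_vec Im w))
      - bilin S (mid l) (map_vec Im w)"
    unfolding eq by (simp add: bilin_of_real[OF S mid_carrier[OF l] w] quad_complex[OF S sym w])
qed

definition quadric :: "real \<Rightarrow> real Matrix.vec set" where
  "quadric n = {l \<in> carrier_vec (m + 4). qform S l = n}"

lemma bigo_bilin:
  assumes x: "\<And>l. l \<in> V \<Longrightarrow> x l \<in> carrier_vec m" and y: "y \<in> carrier_vec m"
    and bigo: "(\<lambda>l. sqrt (quad S (x l))) \<in> O[principal V](h)"
  shows "(\<lambda>l. bilin S (x l) y) \<in> O[principal V](h)"
proof -
  have "(\<lambda>l. bilin S (x l) y) \<in> O[principal V](\<lambda>l. sqrt (quad S (x l)))"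
  proof (rule bigoI[of _ "sqrt (quad S y)"], unfold eventually_principal, rule ballI)
    fix l assume "l \<in> V"
    then show "norm (bilin S (x l) y) \<le> sqrt (quad S y) * norm (sqrt (quad S (x l)))"
      using abs_bilin_le[OF x y, of l] quad_nonneg[OF x, of l] by (simp add: mult.commute)
  qed
  then show ?thesis using bigo by (rule landau_o.big_trans)
qed

lemma domain_D_iff:
  "(z, w, z') \<in> domain_D S \<longleftrightarrow> Im z > 0 \<and> w \<in> carrier_vec m \<and> Im z' > 0 \<and>
    2 * Im z * Im z' - quad S (map_vec Im w) > 0"
  using S by (simp add: domain_D_def Q1_def Im_triple_def)

text \<open>Real and imaginary part of \<open>Q_Ztilde\<close> are linear in \<open>l\<close> with
  coefficients depending only on \<open>Z\<close>, and the corner coordinates and the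
  \<open>S\<close>-norm of \<open>mid l\<close> are at most the root of the height.\<close>

lemma q_lambda_Z_le_height:
  assumes Z: "Z \<in> domain_D S"
  obtains C where "C > 0" "\<And>l. l \<in> quadric n \<Longrightarrow> q_lambda_Z S l Z - n \<le> C * height S l"
proof -
  obtain z w z' where Z_eq: "Z = (z, w, z')" by (cases Z)
  have w: "w \<in> carrier_vec m" and Q1_pos: "2 * Im z * Im z' - quad S (map_vec Im w) > 0"
    using Z unfolding Z_eq domain_D_iff by auto
  have w': "map_vec Re w \<in> carrier_vec m" "map_vec Im w \<in> carrier_vec m" using w by auto
  define q2 where "q2 = 2 * Im z * Im z' - quad S (map_vec Im w)"
  have q2: "q2 > 0" using Q1_pos by (simp add: q2_def)
  let ?V = "carrier_vec (m + 4) :: real Matrix.vec set"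
  let ?h = "\<lambda>l. sqrt (height S l)"
  have nonneg: "height S l \<ge> 0" if "l \<in> ?V" for l using height_bounds(1)[OF that] by (meson order_trans zero_le_power2)
  have [simp]: "(\<lambda>l. l $ 0) \<in> O[principal ?V](?h)" "(\<lambda>l. l $ 1) \<in> O[principal ?V](?h)"
    "(\<lambda>l. l $ (m + 2)) \<in> O[principal ?V](?h)" "(\<lambda>l. l $ (m + 3)) \<in> O[principal ?V](?h)"
    by (rule bigo_sqrtI[of 1 _ _ 1]; simp only: mult_1 height_bounds nonneg zero_less_one)+
  have "(\<lambda>l. sqrt (quad S (mid l))) \<in> O[principal ?V](?h)"
    by (rule bigo_sqrtI[of 1 _ _ 1]) (simp_all add: nonneg height_bounds quad_nonneg)
  then have [simp]: "(\<lambda>l. bilin S (mid l) y) \<in> O[principal ?V](?h)" if "y \<in> carrier_vec m" for y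
    using that by (intro bigo_bilin) auto
  have "(\<lambda>l. l $ 0 + l $ 1 * Re z' + l $ (m + 2) * Re z
      - l $ (m + 3) * (Re z * Re z' - Im z * Im z' - (quad S (map_vec Re w) - quad S (map_vec Im w)) / 2)
      - bilin S (mid l) (map_vec Re w)) \<in> O[principal ?V](?h)"
    using w' by (intro sum_in_bigo) (simp_all del: One_nat_def add_2_eq_Suc')
  then obtain C1 where C1: "C1 > 0" "\<And>l. l \<in> ?V \<Longrightarrow> (Re (Q_Ztilde S l Z))\<^sup>2 \<le> C1 * height S l"
    by (rule bigo_sqrt_squareD[OF _ nonneg]) (auto simp: Z_eq Q_Ztilde_Re_Im[OF _ w])
  have "(\<lambda>l. l $ 1 * Im z' + l $ (m + 2) * Im z
      - l $ (m + 3) * (Re z * Im z' + Im z * Re z' - bilin S (map_vec Re w) (map_vec Im w))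
      - bilin S (mid l) (map_vec Im w)) \<in> O[principal ?V](?h)"
    using w' by (intro sum_in_bigo) (simp_all del: One_nat_def add_2_eq_Suc')
  then obtain C2 where C2: "C2 > 0" "\<And>l. l \<in> ?V \<Longrightarrow> (Im (Q_Ztilde S l Z))\<^sup>2 \<le> C2 * height S l"
    by (rule bigo_sqrt_squareD[OF _ nonneg]) (auto simp: Z_eq Q_Ztilde_Re_Im[OF _ w])
  have "q_lambda_Z S l Z - n \<le> ((C1 + C2) / (2 * q2) + 1) * height S l" if l: "l \<in> quadric n" for l
  proof -
    have l': "l \<in> ?V" and n: "qform S l = n" using l by (auto simp: quadric_def)
    have "(cmod (Q_Ztilde S l Z))\<^sup>2 \<le> (C1 + C2) * height S l"
      using C1(2)[OF l'] C2(2)[OF l'] by (simp add: cmod_power2 distrib_right)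
    then have "(cmod (Q_Ztilde S l Z))\<^sup>2 / (2 * q2) \<le> (C1 + C2) * height S l / (2 * q2)"
      using q2 by (intro divide_right_mono) simp_all
    then have "q_lambda_Z S l Z \<le> (C1 + C2) * height S l / (2 * q2)"
      by (simp add: q_lambda_Z_def Z_eq Q1_def Im_triple_def q2_def)
    moreover have "- n \<le> height S l" using abs_qform_le_height[OF l'] n by simp
    ultimately show ?thesis by (simp add: distrib_right)
  qed
  moreover have "(C1 + C2) / (2 * q2) + 1 > 0" using C1(1) C2(1) q2 by (simp add: add_pos_pos)
  ultimately show ?thesis using that by blast
qed

text \<open>\<open>A\<close> and \<open>B\<close> alone do not control \<open>l\<close>. Combined
  with the equation \<open>qform S l = n\<close> they bound \<open>d\<close>,
  \<open>p * Y' - r * Y\<close> and the \<open>S\<close>-norm of \<open>u'\<close>, from which all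
  coordinates are recovered.\<close>

lemma height_le_q_lambda_Z:
  assumes Z: "Z \<in> domain_D S" and n: "n < 0"
  obtains C where "C > 0" "\<And>l. l \<in> quadric n \<Longrightarrow> height S l \<le> C * (q_lambda_Z S l Z - n)"
proof -
  obtain z w z' where Z_eq: "Z = (z, w, z')" by (cases Z)
  have w: "w \<in> carrier_vec m" and Q1_pos: "2 * Im z * Im z' - quad S (map_vec Im w) > 0"
    and pos: "Im z > 0" "Im z' > 0"
    using Z unfolding Z_eq domain_D_iff by auto
  define X Y X' Y' wr v where "X = Re z" "Y = Im z" "X' = Re z'" "Y' = Im z'"
    "wr = map_vec Re w" "v = map_vec Im w"
  note defs = this
  have wr: "wr \<in> carrier_vec m" and v: "v \<in> carrier_vec m" using w by (auto simp: defs)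
  define q2 where "q2 = 2 * Y * Y' - quad S v"
  have q2: "q2 > 0" using Q1_pos by (simp add: q2_def defs)
  have YY: "Y * Y' > 0" "Y > 0" "Y' > 0" using pos by (simp_all add: defs)
  let ?V = "quadric n"
  define A B d l0 l1 l2 u where "A l = Re (Q_Ztilde S l Z)" "B l = Im (Q_Ztilde S l Z)"
    "d l = l $ (m + 3)" "l0 l = l $ 0" "l1 l = l $ 1" "l2 l = l $ (m + 2)" "u l = mid l" for l
  note ldefs = this
  \<comment> \<open>Translation by \<open>Re Z\<close>: these are the coordinates of
    \<open>l\<close> as seen from the point with real part 0, while \<open>d\<close> is
    unchanged.\<close>
  define p r u' where "p l = l1 l - d l * X" "r l = l2 l - d l * X'" "u' l = u l + (- d l) \<cdot>\<^sub>v wr" for l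
  note pdefs = this
  define T where "T l = q_lambda_Z S l Z - n" for l
  have V: "l \<in> carrier_vec (m + 4)" "qform S l = n" if "l \<in> ?V" for l
    using that by (auto simp: quadric_def)
  have u: "u l \<in> carrier_vec m" "u' l \<in> carrier_vec m" if "l \<in> ?V" for l
    using V[OF that] wr by (auto simp: ldefs pdefs)
  have A: "A l = l0 l + l1 l * X' + l2 l * X - d l * (X * X' - Y * Y' - (quad S wr - quad S v) / 2)
      - bilin S (u l) wr" if "l \<in> ?V" for l
    using Q_Ztilde_Re_Im(1)[OF V(1)[OF that] w] by (simp add: ldefs defs Z_eq)
  have B: "B l = p l * Y' + r l * Y - bilin S (u' l) v" if "l \<in> ?V" for l
    using Q_Ztilde_Re_Im(2)[OF V(1)[OF that] w, of z z'] u[OF that] wr v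
    by (simp add: ldefs defs Z_eq pdefs bilin_add_left[OF S] bilin_smult_left[OF S] algebra_simps)
  \<comment> \<open>\<open>qform S l\<close> in translated coordinates, with the first coordinate
    eliminated in favour of \<open>A l\<close>.\<close>
  have n_eq: "n = d l * A l - (d l)\<^sup>2 * q2 / 2 + p l * r l - quad S (u' l) / 2" if l: "l \<in> ?V" for l
  proof -
    have "n = l0 l * d l + l1 l * l2 l - quad S (u l) / 2"
      using V[OF l] qform_carrier[of l] by (simp add: ldefs)
    moreover have "quad S (u' l) = quad S (u l) - 2 * d l * bilin S (u l) wr + (d l)\<^sup>2 * quad S wr"
      using u[OF l] wr
      by (simp add: pdefs(3) quad_add[OF S sym] bilin_smult_right[OF S] quad_smult[OF S])
    ultimately show ?thesis
      unfolding A[OF l] q2_def pdefs(1,2) by (simp add: field_simps power2_eq_square)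
  qed
  have T: "(A l)\<^sup>2 \<le> 2 * q2 * T l" "(B l)\<^sup>2 \<le> 2 * q2 * T l" "- n \<le> T l" "0 \<le> T l" if "l \<in> ?V" for l
  proof -
    have "T l = ((A l)\<^sup>2 + (B l)\<^sup>2) / (2 * q2) - n"
      by (simp add: T_def q_lambda_Z_def Z_eq Q1_def Im_triple_def q2_def ldefs defs cmod_power2)
    moreover from this have "2 * q2 * T l = (A l)\<^sup>2 + (B l)\<^sup>2 + 2 * q2 * (- n)"
      using q2 by (simp add: field_simps)
    moreover have "((A l)\<^sup>2 + (B l)\<^sup>2) / (2 * q2) \<ge> 0" using q2 by simp
    moreover have "2 * q2 * (- n) \<ge> 0" using q2 n by (intro mult_nonneg_nonneg) auto
    ultimately show "(A l)\<^sup>2 \<le> 2 * q2 * T l" "(B l)\<^sup>2 \<le> 2 * q2 * T l" "- n \<le> T l" "0 \<le> T l"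
      using n zero_le_power2[of "A l"] zero_le_power2[of "B l"] by linarith+
  qed
  obtain \<delta> C where \<delta>: "\<delta> > 0" and C: "C \<ge> 0" and lorentz:
    "\<And>B s U. U \<ge> 0 \<Longrightarrow> s\<^sup>2 \<le> U * quad S v \<Longrightarrow> (B + s)\<^sup>2 / (4 * (Y * Y')) - U / 2 \<le> C * B\<^sup>2 - \<delta> * U"
    using lorentz_bound[OF YY(1) quad_nonneg[OF v]] q2 unfolding q2_def by (auto simp: mult.assoc)
  \<comment> \<open>Collects \<open>- n \<le> T l\<close>,
    \<open>(A l)\<^sup>2 / q2 \<le> 2 * T l\<close> and
    \<open>C * (B l)\<^sup>2 \<le> 2 * q2 * C * T l\<close>.\<close>
  define K where "K = 3 + 2 * q2 * C"
  have main: "q2 / 4 * (d l)\<^sup>2 + (p l * Y' - r l * Y)\<^sup>2 / (4 * (Y * Y')) + \<delta> * quad S (u' l) \<le> K * T l"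
    if l: "l \<in> ?V" for l
  proof -
    let ?s = "bilin S (u' l) v"
    have sum: "p l * Y' + r l * Y = B l + ?s" using B[OF l] by simp
    \<comment> \<open>Splits the hyperbolic plane: \<open>p l * r l\<close> is a multiple of a
      difference of two squares. The first is bounded by \<open>lorentz\<close>, the second moves to
      the left-hand side.\<close>
    have "(p l * Y' + r l * Y)\<^sup>2 - (p l * Y' - r l * Y)\<^sup>2 = 4 * (Y * Y') * (p l * r l)"
      by (simp add: power2_eq_square algebra_simps)
    then have "p l * r l = ((B l + ?s)\<^sup>2 - (p l * Y' - r l * Y)\<^sup>2) / (4 * (Y * Y'))"
      using YY unfolding sum by (simp add: field_simps)
    then have "p l * r l + (p l * Y' - r l * Y)\<^sup>2 / (4 * (Y * Y')) = (B l + ?s)\<^sup>2 / (4 * (Y * Y'))"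
      by (simp add: diff_divide_distrib)
    moreover have "(B l + ?s)\<^sup>2 / (4 * (Y * Y')) - quad S (u' l) / 2 \<le> C * (B l)\<^sup>2 - \<delta> * quad S (u' l)"
      using u[OF l] v by (intro lorentz quad_nonneg Cauchy_Schwarz_bilin)
    \<comment> \<open>The weights are such that only half of the available
      \<open>(d l)\<^sup>2 * q2 / 2\<close> is consumed.\<close>
    moreover have "d l * A l \<le> q2 / 4 * (d l)\<^sup>2 + (A l)\<^sup>2 / q2"
    proof -
      have "0 \<le> (q2 / 2 * d l - A l)\<^sup>2 / q2" using q2 by simp
      also have "\<dots> = q2 / 4 * (d l)\<^sup>2 + (A l)\<^sup>2 / q2 - d l * A l"
        using q2 by (simp add: field_simps power2_eq_square)
      finally show ?thesis by simp
    qed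
    moreover have "(A l)\<^sup>2 / q2 \<le> 2 * T l" using T(1)[OF l] q2 by (simp add: field_simps)
    moreover have "C * (B l)\<^sup>2 \<le> 2 * q2 * C * T l"
      using mult_left_mono[OF T(2)[OF l] C] by (simp add: ac_simps)
    moreover have "K * T l = T l + 2 * T l + 2 * q2 * C * T l" by (simp add: K_def algebra_simps)
    moreover have "(d l)\<^sup>2 * q2 / 2 = q2 / 4 * (d l)\<^sup>2 + q2 / 4 * (d l)\<^sup>2" by simp
    ultimately show ?thesis using n_eq[OF l] T(3)[OF l] by linarith
  qed
  let ?h = "\<lambda>l. sqrt (T l)" and ?F = "principal ?V"
  have parts_nonneg: "q2 / 4 * (d l)\<^sup>2 \<ge> 0" "(p l * Y' - r l * Y)\<^sup>2 / (4 * (Y * Y')) \<ge> 0"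
    "\<delta> * quad S (u' l) \<ge> 0" if "l \<in> ?V" for l
    using q2 YY \<delta> quad_nonneg[OF u(2)[OF that]] by simp_all
  have d: "d \<in> O[?F](?h)"
    by (rule bigo_sqrtI[of "q2 / 4" _ _ K]) (use q2 main parts_nonneg T(4) in force)+
  have pr: "(\<lambda>l. p l * Y' - r l * Y) \<in> O[?F](?h)"
    by (rule bigo_sqrtI[of "1 / (4 * (Y * Y'))" _ _ K]) (use YY main parts_nonneg T(4) in force)+
  have u'_bigo: "(\<lambda>l. sqrt (quad S (u' l))) \<in> O[?F](?h)"
  proof (rule bigo_sqrtI[of \<delta> _ _ K])
    show "\<delta> * (sqrt (quad S (u' l)))\<^sup>2 \<le> K * T l" if "l \<in> ?V" for l
      using main[OF that] parts_nonneg[OF that] quad_nonneg[OF u(2)[OF that]] by simp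
  qed (use \<delta> T(4) in auto)
  have AB: "A \<in> O[?F](?h)" "B \<in> O[?F](?h)"
    by (rule bigo_sqrtI[of 1 _ _ "2 * q2"]; use T in simp)+
  \<comment> \<open>This bounds the sum \<open>p l * Y' + r l * Y\<close>; with the difference
    \<open>pr\<close> it yields \<open>p\<close> and \<open>r\<close> separately.\<close>
  have "(\<lambda>l. B l + bilin S (u' l) v) \<in> O[?F](?h)"
    using AB(2) bigo_bilin[OF u(2) v u'_bigo] by (rule sum_in_bigo)
  then have sum: "(\<lambda>l. p l * Y' + r l * Y) \<in> O[?F](?h)"
    by (rule landau_o.big.in_cong[THEN iffD1, rotated]) (simp add: eventually_principal B)
  have "(\<lambda>l. (p l * Y' + r l * Y + (p l * Y' - r l * Y)) / (2 * Y')) \<in> O[?F](?h)"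
    using sum_in_bigo(1)[OF sum pr] YY by simp
  then have p: "p \<in> O[?F](?h)" using YY by (simp add: field_simps)
  have "(\<lambda>l. (p l * Y' + r l * Y - (p l * Y' - r l * Y)) / (2 * Y)) \<in> O[?F](?h)"
    using sum_in_bigo(2)[OF sum pr] YY by simp
  then have r: "r \<in> O[?F](?h)" using YY by (simp add: field_simps)
  have "(\<lambda>l. p l + d l * X) \<in> O[?F](?h)" using p d by (intro sum_in_bigo) simp_all
  then have l1: "l1 \<in> O[?F](?h)" by (simp add: pdefs)
  have "(\<lambda>l. r l + d l * X') \<in> O[?F](?h)" using r d by (intro sum_in_bigo) simp_all
  then have l2: "l2 \<in> O[?F](?h)" by (simp add: pdefs)
  have u_bigo: "(\<lambda>l. sqrt (quad S (u l))) \<in> O[?F](?h)"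
  proof -
    have "(\<lambda>l. sqrt (quad S (u' l)) + \<bar>d l\<bar> * sqrt (quad S wr)) \<in> O[?F](?h)"
      using u'_bigo d by (intro sum_in_bigo) simp_all
    moreover have "(\<lambda>l. sqrt (quad S (u l))) \<in> O[?F](\<lambda>l. sqrt (quad S (u' l)) + \<bar>d l\<bar> * sqrt (quad S wr))"
    proof (rule bigoI[of _ 1], unfold eventually_principal, rule ballI)
      fix l assume l: "l \<in> ?V"
      have "u l = u' l + d l \<cdot>\<^sub>v wr" using u[OF l] wr by (intro eq_vecI) (auto simp: pdefs(3))
      then have "sqrt (quad S (u l)) \<le> sqrt (quad S (u' l)) + sqrt (quad S (d l \<cdot>\<^sub>v wr))"
        using sqrt_quad_triangle[OF u(2)[OF l], of "d l \<cdot>\<^sub>v wr"] wr by simp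
      also have "sqrt (quad S (d l \<cdot>\<^sub>v wr)) = \<bar>d l\<bar> * sqrt (quad S wr)"
        using wr by (simp add: quad_smult[OF S] real_sqrt_mult)
      finally show "norm (sqrt (quad S (u l))) \<le>
          1 * norm (sqrt (quad S (u' l)) + \<bar>d l\<bar> * sqrt (quad S wr))"
        using quad_nonneg u[OF l] wr by simp
    qed
    ultimately show ?thesis by (rule landau_o.big_trans[rotated])
  qed
  \<comment> \<open>The formula for \<open>A l\<close>, solved for the first coordinate.\<close>
  have "(\<lambda>l. A l - l1 l * X' - l2 l * X + d l * (X * X' - Y * Y' - (quad S wr - quad S v) / 2)
      + bilin S (u l) wr) \<in> O[?F](?h)"
    using AB l1 l2 d bigo_bilin[OF u(1) wr u_bigo] by (intro sum_in_bigo) simp_all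
  then have l0: "l0 \<in> O[?F](?h)"
    by (rule landau_o.big.in_cong[THEN iffD1, rotated]) (simp add: eventually_principal A)
  obtain C0 where C0: "C0 > 0" "\<And>l. l \<in> ?V \<Longrightarrow> (l0 l)\<^sup>2 \<le> C0 * T l"
    using bigo_sqrt_squareD[OF l0 T(4)] by blast
  obtain C1 where C1: "C1 > 0" "\<And>l. l \<in> ?V \<Longrightarrow> (l1 l)\<^sup>2 \<le> C1 * T l"
    using bigo_sqrt_squareD[OF l1 T(4)] by blast
  obtain C2 where C2: "C2 > 0" "\<And>l. l \<in> ?V \<Longrightarrow> (l2 l)\<^sup>2 \<le> C2 * T l"
    using bigo_sqrt_squareD[OF l2 T(4)] by blast
  obtain C3 where C3: "C3 > 0" "\<And>l. l \<in> ?V \<Longrightarrow> (d l)\<^sup>2 \<le> C3 * T l"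
    using bigo_sqrt_squareD[OF d T(4)] by blast
  obtain C4 where C4: "C4 > 0" "\<And>l. l \<in> ?V \<Longrightarrow> (sqrt (quad S (u l)))\<^sup>2 \<le> C4 * T l"
    using bigo_sqrt_squareD[OF u_bigo T(4)] by blast
  have "height S l \<le> (C0 + C1 + C2 + C3 + C4) * T l" if l: "l \<in> ?V" for l
    using C0(2)[OF l] C1(2)[OF l] C2(2)[OF l] C3(2)[OF l] C4(2)[OF l] quad_nonneg[OF u(1)[OF l]]
    by (simp add: height_eq ldefs distrib_right)
  moreover have "C0 + C1 + C2 + C3 + C4 > 0" using C0 C1 C2 C3 C4 by simp
  ultimately show ?thesis using that unfolding T_def by blast
qed

end

section \<open>Summability\<close>

text \<open>A bound on the ratio of successive coefficients gives a positive radius of convergence;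
  \<open>Re c > 0\<close> keeps \<open>c + k\<close> away from 0.\<close>

lemma isCont_hypergeom_0:
  assumes c: "Re c > 0"
  shows "isCont (hypergeom a b c) 0"
proof -
  define cf where "cf k = pochhammer a k * pochhammer b k / pochhammer c k / fact k" for k
  define B where "B = (cmod a / Re c + 1) * (cmod b + 1)"
  have B: "B > 0" using c by (auto simp: B_def intro!: mult_pos_pos add_nonneg_pos)
  have step: "cmod (cf (Suc k)) \<le> B * cmod (cf k)" for k
  proof -
    have "Re c + real k \<le> cmod (c + of_nat k)"
      using complex_Re_le_cmod[of "c + of_nat k"] by simp
    moreover have "cmod (a + of_nat k) \<le> (cmod a / Re c + 1) * (Re c + real k)"
    proof -
      have "cmod (a + of_nat k) \<le> cmod a + real k" by (metis norm_of_nat norm_triangle_ineq)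
      also have "\<dots> \<le> (cmod a / Re c + 1) * (Re c + real k)" using c by (simp add: field_simps)
      finally show ?thesis .
    qed
    moreover have "0 \<le> cmod a / Re c + 1" using c by simp
    ultimately have 1: "cmod (a + of_nat k) \<le> (cmod a / Re c + 1) * cmod (c + of_nat k)"
      by (meson mult_left_mono order_trans)
    have pos: "cmod (c + of_nat k) > 0" using \<open>Re c + real k \<le> cmod (c + of_nat k)\<close> c by linarith
    have "cmod (b + of_nat k) \<le> cmod b + real k" by (metis norm_of_nat norm_triangle_ineq)
    also have "\<dots> \<le> (cmod b + 1) * (1 + real k)" by (simp add: field_simps)
    finally have 2: "cmod (b + of_nat k) \<le> (cmod b + 1) * (1 + real k)" .
    have "cf (Suc k) = cf k * ((a + of_nat k) * (b + of_nat k) / ((c + of_nat k) * of_nat (Suc k)))"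
      by (simp add: cf_def pochhammer_Suc field_simps)
    then have eq: "cmod (cf (Suc k)) =
        cmod (cf k) * (cmod (a + of_nat k) * cmod (b + of_nat k) / (cmod (c + of_nat k) * (1 + real k)))"
      by (simp only: norm_mult norm_divide norm_of_nat) simp
    have le: "cmod (a + of_nat k) * cmod (b + of_nat k) / (cmod (c + of_nat k) * (1 + real k)) \<le> B"
    proof -
      have "cmod (a + of_nat k) * cmod (b + of_nat k) \<le>
          ((cmod a / Re c + 1) * cmod (c + of_nat k)) * ((cmod b + 1) * (1 + real k))"
        using c by (intro mult_mono 1 2) auto
      also have "\<dots> = B * (cmod (c + of_nat k) * (1 + real k))" by (simp add: B_def)
      finally show ?thesis using pos by (subst pos_divide_le_eq) auto
    qed
    show ?thesis unfolding eq using mult_left_mono[OF le, of "cmod (cf k)"] by (simp add: mult.commute)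
  qed
  \<comment> \<open>With this radius successive terms shrink at least by the factor 1/2.\<close>
  define r where "r = 1 / (2 * B)"
  have r: "r > 0" "B * r = 1 / 2" using B by (simp_all add: r_def)
  have "summable (\<lambda>k. cf k * complex_of_real r ^ k)"
  proof (rule summable_ratio_test[of "1 / 2" 0])
    fix k
    have "cmod (cf (Suc k) * complex_of_real r ^ Suc k) = cmod (cf (Suc k)) * r * r ^ k"
      using r by (simp add: norm_mult norm_power)
    also have "\<dots> \<le> (B * cmod (cf k)) * r * r ^ k"
      using step r by (intro mult_right_mono) auto
    also have "\<dots> = (B * r) * (cmod (cf k) * r ^ k)" by (simp add: ac_simps)
    also have "cmod (cf k) * r ^ k = cmod (cf k * complex_of_real r ^ k)"
      using r by (simp add: norm_mult norm_power)
    finally show "cmod (cf (Suc k) * complex_of_real r ^ Suc k) \<le> 1 / 2 * cmod (cf k * complex_of_real r ^ k)"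
      unfolding r(2) .
  qed simp
  then have "isCont (\<lambda>z. \<Sum>k. cf k * z ^ k) 0"
    by (rule isCont_powser) (use r in simp)
  moreover have "hypergeom a b c = (\<lambda>z. \<Sum>k. cf k * z ^ k)"
    by (simp add: fun_eq_iff hypergeom_def cf_def)
  ultimately show ?thesis by simp
qed

lemma hypergeom_0: "hypergeom a b c 0 = 1"
proof -
  have "(\<lambda>k. pochhammer a k * pochhammer b k / pochhammer c k * (0 ^ k / fact k)) = (\<lambda>k. if k = 0 then 1 else 0)"
    by (auto simp: fun_eq_iff)
  then show ?thesis
    using sums_unique[OF sums_single[of 0 "\<lambda>_. 1 :: complex"]] unfolding hypergeom_def by simp
qed

lemma summable_on_Diff_finite_iff:
  fixes f :: "'a \<Rightarrow> 'b :: {topological_ab_group_add, t2_space}"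
  assumes "finite E"
  shows "f summable_on (X - E) \<longleftrightarrow> f summable_on X"
proof
  assume "f summable_on (X - E)"
  moreover have "f summable_on (X \<inter> E)" using assms by (intro summable_on_finite) auto
  ultimately have "f summable_on ((X - E) \<union> (X \<inter> E))" by (rule summable_on_Un_disjoint) auto
  then show "f summable_on X" by (simp only: Un_Diff_Int)
qed (rule summable_on_cofin_subset[OF _ assms])

text \<open>For complex terms summability is absolute summability, so a two-sided comparison outside
  a finite set decides it.\<close>

lemma summable_on_iff_comparable:
  fixes f :: "'a \<Rightarrow> complex" and g :: "'a \<Rightarrow> real"
  assumes "finite E" "c > 0"
    and "\<And>x. x \<in> X - E \<Longrightarrow> c * g x \<le> cmod (f x)" "\<And>x. x \<in> X - E \<Longrightarrow> cmod (f x) \<le> C * g x"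
    and g: "\<And>x. x \<in> X - E \<Longrightarrow> g x \<ge> 0"
  shows "f summable_on X \<longleftrightarrow> g summable_on X"
proof -
  have "f summable_on (X - E) \<longleftrightarrow> g summable_on (X - E)"
  proof
    assume "f summable_on (X - E)"
    then have "(\<lambda>x. 1 / c * cmod (f x)) summable_on (X - E)"
      by (intro summable_on_cmult_right) (simp add: summable_on_iff_abs_summable_on_complex[symmetric])
    then have "(\<lambda>x. norm (g x)) summable_on (X - E)"
      by (rule Infinite_Sum.abs_summable_on_comparison_test')
        (use assms in \<open>simp add: field_simps\<close>)
    then show "g summable_on (X - E)" by (rule abs_summable_summable)
  next
    assume "g summable_on (X - E)"
    then have "(\<lambda>x. C * g x) summable_on (X - E)" by (rule summable_on_cmult_right)
    then have "(\<lambda>x. cmod (f x)) summable_on (X - E)"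
      by (rule Infinite_Sum.abs_summable_on_comparison_test') (use assms in auto)
    then show "f summable_on (X - E)" by (rule abs_summable_summable)
  qed
  then show ?thesis by (simp add: summable_on_Diff_finite_iff[OF assms(1)])
qed

text \<open>The summand as a function of the value of \<open>q_lambda_Z\<close> alone, so that terms
  for different points and vectors can be matched by that value.\<close>

definition green_term :: "int mat \<Rightarrow> real \<Rightarrow> complex \<Rightarrow> real \<Rightarrow> complex" where
  "green_term S n s q = (let k = complex_of_real (kappa S); u = complex_of_real (n / (n - q)) in
    u powr (s + k / 2 - 1) * hypergeom (s + k / 2 - 1) (s - k / 2 + 1) (2 * s) u)"

lemma Phi_eq_infsum:
  "Phi S \<alpha> n Z s = 2 * (Gamma (s + complex_of_real (kappa S) / 2 - 1) / Gamma (2 * s)) *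
    (\<Sum>\<^sub>\<infinity>l \<in> {l \<in> \<alpha>. qform S l = n}. green_term S n s (q_lambda_Z S l Z))"
  by (simp add: Phi_def green_term_def Let_def)

context posdef_form
begin

text \<open>Bounded height bounds every coordinate, and a coset of the integers meets a bounded
  interval in finitely many points.\<close>

lemma finite_height_le:
  "finite {l \<in> carrier_vec (m + 4). (\<forall>i<m + 4. l $ i - x $ i \<in> \<int>) \<and> height S l \<le> R}"
proof -
  obtain C where C: "\<And>(u :: real Matrix.vec) i. u \<in> carrier_vec m \<Longrightarrow> i < m \<Longrightarrow> (u $ i)\<^sup>2 \<le> C * quad S u"
    using coordinate_bound by blast
  \<comment> \<open>The summand 1 serves the corner coordinates, \<open>\<bar>C\<bar>\<close> the
    middle ones.\<close>
  define B where "B = sqrt ((1 + \<bar>C\<bar>) * R)"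
  have bound: "\<bar>l $ i\<bar> \<le> B"
    if l: "l \<in> carrier_vec (m + 4)" and R: "height S l \<le> R" and i: "i < m + 4" for l i
  proof -
    have h0: "0 \<le> height S l" using height_bounds(1)[OF l] by (meson order_trans zero_le_power2)
    have "(l $ i)\<^sup>2 \<le> (1 + \<bar>C\<bar>) * height S l"
    proof -
      show ?thesis
      proof (cases "i \<in> {0, 1, m + 2, m + 3}")
        case True
        then have "(l $ i)\<^sup>2 \<le> height S l" using height_bounds[OF l] by auto
        then show ?thesis using h0 by (simp add: distrib_right add_increasing2)
      next
        case False
        define j where "j = i - 2"
        have j: "j < m" "i = j + 2" using False i by (auto simp: j_def)
        have "(l $ i)\<^sup>2 = (mid l $ j)\<^sup>2" using j l by (simp add: mid_def)
        also have "\<dots> \<le> C * quad S (mid l)" using C[OF mid_carrier[OF l] j(1)] .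
        also have "\<dots> \<le> \<bar>C\<bar> * height S l"
          using height_bounds(5)[OF l] quad_nonneg[OF mid_carrier[OF l]] by (intro mult_mono) auto
        finally show ?thesis using h0 by (simp add: distrib_right)
      qed
    qed
    also have "\<dots> \<le> (1 + \<bar>C\<bar>) * R" using R by (intro mult_left_mono) auto
    finally show ?thesis unfolding B_def by (metis real_sqrt_abs real_sqrt_le_iff)
  qed
  show ?thesis
  proof (rule finite_subset)
    show "finite {l \<in> carrier_vec (m + 4). \<forall>i<m + 4. l $ i \<in> {r. r - x $ i \<in> \<int> \<and> \<bar>r\<bar> \<le> B}}"
      by (intro finite_vec_set finite_bounded_int_coset)
    show "{l \<in> carrier_vec (m + 4). (\<forall>i<m + 4. l $ i - x $ i \<in> \<int>) \<and> height S l \<le> R} \<subseteq>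
        {l \<in> carrier_vec (m + 4). \<forall>i<m + 4. l $ i \<in> {r. r - x $ i \<in> \<int> \<and> \<bar>r\<bar> \<le> B}}"
      using bound by blast
  qed
qed

text \<open>The right-hand side does not depend on \<open>Z\<close>. If it fails, every infinite sum in the theorem is
  non-summable and hence \<open>0\<close> by convention, so convergence need not be proved.\<close>

lemma summable_green_iff:
  assumes Z: "Z \<in> domain_D S" and n: "n < 0" and s: "Re s > kappa S / 2"
    and X: "X \<subseteq> {l \<in> quadric n. \<forall>i<m + 4. l $ i - x $ i \<in> \<int>}"
  shows "(\<lambda>l. green_term S n s (q_lambda_Z S l Z)) summable_on X \<longleftrightarrow>
    (\<lambda>l. height S l powr - (Re s + kappa S / 2 - 1)) summable_on X"
proof -
  define \<sigma> where "\<sigma> = Re s + kappa S / 2 - 1"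
  have kappa: "kappa S \<ge> 2" by (simp add: kappa_def)
  have \<sigma>: "\<sigma> > 0" and s0: "Re (2 * s) > 0" using s kappa by (simp_all add: \<sigma>_def)
  define F where "F = hypergeom (s + complex_of_real (kappa S) / 2 - 1)
    (s - complex_of_real (kappa S) / 2 + 1) (2 * s)"
  have "isCont F 0" unfolding F_def by (rule isCont_hypergeom_0[OF s0])
  then have "\<exists>\<delta>>0. \<forall>z. dist z 0 < \<delta> \<longrightarrow> dist (F z) (F 0) < 1 / 2"
    unfolding continuous_at_eps_delta by - (drule spec[of _ "1 / 2 :: real"], simp)
  moreover have "F 0 = 1" by (simp add: F_def hypergeom_0)
  ultimately obtain \<delta> where \<delta>: "\<delta> > 0" "\<And>z. cmod z < \<delta> \<Longrightarrow> cmod (F z - 1) < 1 / 2"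
    by (auto simp: dist_norm)
  obtain C1 where C1: "C1 > 0" "\<And>l. l \<in> quadric n \<Longrightarrow> q_lambda_Z S l Z - n \<le> C1 * height S l"
    using q_lambda_Z_le_height[OF Z] by blast
  obtain C2 where C2: "C2 > 0" "\<And>l. l \<in> quadric n \<Longrightarrow> height S l \<le> C2 * (q_lambda_Z S l Z - n)"
    using height_le_q_lambda_Z[OF Z n] by blast
  \<comment> \<open>Height above \<open>R\<close> forces
    \<open>n / (n - q_lambda_Z S l Z) < \<delta>\<close>, where the hypergeometric factor has
    modulus between 1/2 and 3/2. The exceptions form the finite set \<open>E\<close>.\<close>
  define R where "R = - n * C2 / \<delta>"
  define E where "E = {l \<in> carrier_vec (m + 4). (\<forall>i<m + 4. l $ i - x $ i \<in> \<int>) \<and> height S l \<le> R}"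
  have E: "finite E" unfolding E_def by (rule finite_height_le)
  let ?g = "\<lambda>l. height S l powr - \<sigma>" and ?f = "\<lambda>l. green_term S n s (q_lambda_Z S l Z)"
  have est: "(1 / 2 * (- n) powr \<sigma> * C1 powr - \<sigma>) * ?g l \<le> cmod (?f l) \<and>
      cmod (?f l) \<le> (3 / 2 * (- n) powr \<sigma> * C2 powr \<sigma>) * ?g l" if l: "l \<in> X - E" for l
  proof -
    define t where "t = q_lambda_Z S l Z - n"
    define u where "u = - n / t"
    have lq: "l \<in> quadric n" and lc: "l \<in> carrier_vec (m + 4)" using l X by (auto simp: quadric_def)
    have hR: "height S l > R" using l X lc unfolding E_def by auto
    have h: "height S l > 0"
      using abs_qform_le_height[OF lc] n lq by (simp add: quadric_def)
    have t: "t > 0" using C2(2)[OF lq] C2(1) h by (metis less_le_trans t_def zero_less_mult_pos)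
    have u: "u > 0" unfolding u_def using t n by (intro divide_pos_pos) auto
    have "u < \<delta>"
    proof -
      have "- n * C2 < height S l * \<delta>" using hR \<delta>(1) by (simp add: R_def field_simps)
      also have "\<dots> \<le> C2 * t * \<delta>" using C2(2)[OF lq] \<delta>(1) by (simp add: t_def)
      finally have "C2 * (- n) < C2 * (\<delta> * t)" by (simp add: ac_simps)
      then have "- n < \<delta> * t" using C2(1) by (simp only: mult_less_cancel_left_pos)
      then show ?thesis using t by (simp add: u_def field_simps)
    qed
    then have Fu: "cmod (F (of_real u) - 1) < 1 / 2" using u by (intro \<delta>) simp
    have "cmod (F (of_real u)) \<le> cmod (F (of_real u) - 1) + 1"
      using norm_triangle_ineq[of "F (of_real u) - 1" 1] by simp
    moreover have "1 \<le> cmod (F (of_real u)) + cmod (F (of_real u) - 1)"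
      using norm_triangle_ineq4[of "F (of_real u)" "F (of_real u) - 1"] by simp
    ultimately have F: "1 / 2 \<le> cmod (F (of_real u))" "cmod (F (of_real u)) \<le> 3 / 2"
      using Fu by linarith+
    have u_eq: "n / (n - q_lambda_Z S l Z) = u"
      unfolding u_def t_def by (metis minus_diff_eq minus_divide_divide)
    have f: "cmod (?f l) = u powr \<sigma> * cmod (F (of_real u))"
      using u by (simp add: green_term_def Let_def u_eq F_def \<sigma>_def norm_mult norm_powr_real_powr)
    have u_powr: "u powr \<sigma> = (- n) powr \<sigma> * t powr - \<sigma>"
      unfolding u_def by (subst powr_divide) (use n t in \<open>auto simp: powr_minus_divide\<close>)
    \<comment> \<open>The exponent is negative, so the upper bound for \<open>t\<close> gives the
      lower bound for its power, and conversely below.\<close>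
    have "(C1 * height S l) powr - \<sigma> \<le> t powr - \<sigma>"
      using C1(2)[OF lq] t \<sigma> by (intro powr_mono2') (auto simp: t_def)
    then have lower: "C1 powr - \<sigma> * ?g l \<le> t powr - \<sigma>" using C1(1) h by (simp add: powr_mult)
    have "t powr - \<sigma> \<le> (height S l / C2) powr - \<sigma>"
      using C2(2)[OF lq] C2(1) h \<sigma> by (intro powr_mono2') (auto simp: t_def field_simps)
    then have upper: "t powr - \<sigma> \<le> C2 powr \<sigma> * ?g l"
      using C2(1) h by (simp add: powr_divide powr_minus_divide)
    have "(1 / 2 * (- n) powr \<sigma> * C1 powr - \<sigma>) * ?g l = (- n) powr \<sigma> * (C1 powr - \<sigma> * ?g l) * (1 / 2)"
      by simp
    also have "\<dots> \<le> (- n) powr \<sigma> * t powr - \<sigma> * cmod (F (of_real u))"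
      using F lower by (intro mult_mono mult_left_mono) auto
    finally have 1: "(1 / 2 * (- n) powr \<sigma> * C1 powr - \<sigma>) * ?g l \<le> cmod (?f l)" by (simp add: f u_powr)
    have "(- n) powr \<sigma> * t powr - \<sigma> * cmod (F (of_real u)) \<le> (- n) powr \<sigma> * (C2 powr \<sigma> * ?g l) * (3 / 2)"
      using F upper by (intro mult_mono mult_left_mono) auto
    also have "\<dots> = (3 / 2 * (- n) powr \<sigma> * C2 powr \<sigma>) * ?g l" by simp
    finally have 2: "cmod (?f l) \<le> (3 / 2 * (- n) powr \<sigma> * C2 powr \<sigma>) * ?g l" by (simp add: f u_powr)
    show ?thesis using 1 2 by blast
  qed
  have "?f summable_on X \<longleftrightarrow> ?g summable_on X"
  proof (rule summable_on_iff_comparable[OF E, where C = "3 / 2 * (- n) powr \<sigma> * C2 powr \<sigma>"])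
    show "1 / 2 * (- n) powr \<sigma> * C1 powr - \<sigma> > 0" using n C1(1) by simp
  qed (use est in blast, use est in blast, simp)
  then show ?thesis by (simp add: \<sigma>_def)
qed

end

section \<open>Matrix products and fibres\<close>

text \<open>A single sum over pairs permits a reindexing that mixes the matrix with the lattice
  vector.\<close>

lemma sum_infsum_Times:
  fixes f :: "'a \<Rightarrow> 'b \<Rightarrow> 'c :: {topological_comm_monoid_add, t2_space}"
  assumes H: "finite H" and f: "\<And>A. A \<in> H \<Longrightarrow> f A summable_on I"
  shows "(\<Sum>A\<in>H. infsum (f A) I) = infsum (\<lambda>(A, i). f A i) (H \<times> I)"
proof -
  let ?f = "\<lambda>(A, i). f A i"
  have bij: "bij_betw (Pair A) I ({A} \<times> I)" for A :: 'a
    by (auto simp: bij_betw_def inj_on_def)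
  have "(\<Sum>A\<in>H. infsum (f A) I) = (\<Sum>A\<in>H. infsum ?f ({A} \<times> I))"
    using infsum_reindex_bij_betw[OF bij, of ?f] by simp
  also have "\<dots> = infsum ?f (\<Union>A\<in>H. {A} \<times> I)"
  proof (rule sum_infsum[OF H])
    show "?f summable_on {A} \<times> I" if "A \<in> H" for A
      using summable_on_reindex_bij_betw[OF bij, of ?f A] f[OF that] by simp
  qed auto
  also have "(\<Union>A\<in>H. {A} \<times> I) = H \<times> I" by auto
  finally show ?thesis .
qed

text \<open>Fibres over the same value are matched separately, and the matchings glue to one
  permutation of \<open>X\<close>.\<close>

lemma bij_betw_of_card_fibres:
  assumes fin: "\<And>y. finite {x \<in> X. f x = y}" "\<And>y. finite {x \<in> X. g x = y}"
    and card: "\<And>y. card {x \<in> X. f x = y} = card {x \<in> X. g x = y}"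
  obtains h where "bij_betw h X X" "\<And>x. x \<in> X \<Longrightarrow> g (h x) = f x"
proof -
  have "\<exists>h. bij_betw h {x \<in> X. f x = y} {x \<in> X. g x = y}" for y
    using fin card by (intro finite_same_card_bij)
  then obtain h where h: "bij_betw (h y) {x \<in> X. f x = y} {x \<in> X. g x = y}" for y by metis
  have mem: "h (f x) x \<in> X" "g (h (f x) x) = f x" if "x \<in> X" for x
    using bij_betwE[OF h[of "f x"]] that by auto
  have "bij_betw (\<lambda>x. h (f x) x) X X"
  proof (rule bij_betwI')
    fix x x' assume x: "x \<in> X" "x' \<in> X"
    show "h (f x) x = h (f x') x' \<longleftrightarrow> x = x'"
    proof
      assume eq: "h (f x) x = h (f x') x'"
      then have "f x = f x'" using mem x by metis
      then show "x = x'" using eq x bij_betw_imp_inj_on[OF h[of "f x"]] by (auto dest: inj_onD)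
    qed simp
  next
    fix y assume y: "y \<in> X"
    then have "y \<in> h (g y) ` {x \<in> X. f x = g y}" using bij_betw_imp_surj_on[OF h[of "g y"]] by auto
    then show "\<exists>x\<in>X. y = h (f x) x" by force
  qed (rule mem)
  then show ?thesis using mem(2) by (rule that)
qed

section \<open>Left and right multiplication by Hecke matrices\<close>

type_synonym int_mat2 = "int \<times> int \<times> int \<times> int"

text \<open>With \<open>A = [[a, b], [0, d]]\<close> and \<open>X = [[x1, x2], [x3, x4]]\<close>, the two products are
  \<open>A\<^sup>T X\<close> and \<open>X A\<close>.\<close>

fun hecke_mult_left :: "int \<times> int \<times> int \<Rightarrow> int_mat2 \<Rightarrow> int_mat2" where
  "hecke_mult_left (a, b, d) (x1, x2, x3, x4) = (a * x1, a * x2, b * x1 + d * x3, b * x2 + d * x4)"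

fun hecke_mult_right :: "int \<times> int \<times> int \<Rightarrow> int_mat2 \<Rightarrow> int_mat2" where
  "hecke_mult_right (a, b, d) (x1, x2, x3, x4) = (a * x1, b * x1 + d * x2, a * x3, b * x3 + d * x4)"

fun det2 :: "int_mat2 \<Rightarrow> int" where
  "det2 (x1, x2, x3, x4) = x1 * x4 - x2 * x3"

lemma det2_hecke_mult:
  assumes "A \<in> hecke_reps N"
  shows "det2 (hecke_mult_left A X) = int N * det2 X" "det2 (hecke_mult_right A X) = int N * det2 X"
proof -
  obtain a b d where A: "A = (a, b, d)" by (cases A)
  have N: "int N = a * d" using assms by (simp add: hecke_reps_def A)
  show "det2 (hecke_mult_left A X) = int N * det2 X" "det2 (hecke_mult_right A X) = int N * det2 X"
    unfolding N by (cases X; simp add: A algebra_simps)+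
qed

lemma inj_hecke_mult:
  assumes "A \<in> hecke_reps N"
  shows "inj (hecke_mult_left A)" "inj (hecke_mult_right A)"
  using assms by (auto simp: hecke_reps_def inj_def)

text \<open>\<open>A\<^sup>T\<close> maps a column \<open>(x, y)\<close> to
  \<open>(a * x, b * x + d * y)\<close>, the general lattice element, so the range is tested column
  by column. In the product \<open>X A\<close> rows play this role.\<close>

lemma range_hecke_mult_left:
  "(y1, y2, y3, y4) \<in> range (hecke_mult_left A) \<longleftrightarrow>
    (y1, y3) \<in> hecke_lattice A \<and> (y2, y4) \<in> hecke_lattice A"
proof (cases A)
  case (fields a b d)
  show ?thesis unfolding fields mem_hecke_lattice
  proof (intro iffI; elim conjE exE rangeE)
    fix x y x' y' assume "y1 = a * x" "y3 = b * x + d * y" "y2 = a * x'" "y4 = b * x' + d * y'"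
    then show "(y1, y2, y3, y4) \<in> range (hecke_mult_left (a, b, d))"
      by (intro image_eqI[of _ _ "(x, x', y, y')"]) auto
  next
    fix X assume "(y1, y2, y3, y4) = hecke_mult_left (a, b, d) X"
    then show "(\<exists>x y. y1 = a * x \<and> y3 = b * x + d * y) \<and> (\<exists>x y. y2 = a * x \<and> y4 = b * x + d * y)"
      by (cases X) (simp only: hecke_mult_left.simps prod.inject, blast)
  qed
qed

lemma range_hecke_mult_right:
  "(y1, y2, y3, y4) \<in> range (hecke_mult_right A) \<longleftrightarrow>
    (y1, y2) \<in> hecke_lattice A \<and> (y3, y4) \<in> hecke_lattice A"
proof (cases A)
  case (fields a b d)
  show ?thesis unfolding fields mem_hecke_lattice
  proof (intro iffI; elim conjE exE rangeE)
    fix x y x' y' assume "y1 = a * x" "y2 = b * x + d * y" "y3 = a * x'" "y4 = b * x' + d * y'"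
    then show "(y1, y2, y3, y4) \<in> range (hecke_mult_right (a, b, d))"
      by (intro image_eqI[of _ _ "(x, y, x', y')"]) auto
  next
    fix X assume "(y1, y2, y3, y4) = hecke_mult_right (a, b, d) X"
    then show "(\<exists>x y. y1 = a * x \<and> y2 = b * x + d * y) \<and> (\<exists>x y. y3 = a * x \<and> y4 = b * x + d * y)"
      by (cases X) (simp only: hecke_mult_right.simps prod.inject, blast)
  qed
qed

text \<open>By injectivity each \<open>A\<close> admits at most one \<open>X\<close> with product
  \<open>Y\<close>, so the fibre is counted by the \<open>A\<close> whose range contains
  \<open>Y\<close>. The parameter \<open>\<mu>\<close> stands for either product.\<close>

lemma card_hecke_mult_fibre:
  fixes \<mu> :: "int \<times> int \<times> int \<Rightarrow> int_mat2 \<Rightarrow> int_mat2" and \<beta> :: "'u set" and c :: "'u \<Rightarrow> real"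
  assumes N: "N > 0"
    and det: "\<forall>A\<in>hecke_reps N. \<forall>X. det2 (\<mu> A X) = int N * det2 X"
    and inj: "\<forall>A\<in>hecke_reps N. inj (\<mu> A)"
  defines "I \<equiv> {(X, u). u \<in> \<beta> \<and> real_of_int (det2 X) = c u}"
  shows "finite {x \<in> hecke_reps N \<times> I. (\<mu> (fst x) (fst (snd x)), snd (snd x)) = (Y, u)}" (is "finite ?F")
    and "card {x \<in> hecke_reps N \<times> I. (\<mu> (fst x) (fst (snd x)), snd (snd x)) = (Y, u)} =
      (if u \<in> \<beta> \<and> real_of_int (det2 Y) = real N * c u
       then card {A \<in> hecke_reps N. Y \<in> range (\<mu> A)} else 0)"
proof -
  have inj_fst: "inj_on fst ?F"
  proof (rule inj_onI)
    fix x x' assume x: "x \<in> ?F" "x' \<in> ?F" "fst x = fst x'"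
    then have "\<mu> (fst x) (fst (snd x)) = \<mu> (fst x) (fst (snd x'))" "fst x \<in> hecke_reps N" by auto
    then have "fst (snd x) = fst (snd x')" using inj by (metis injD)
    then show "x = x'" using x by (simp add: prod_eq_iff)
  qed
  have "fst ` ?F \<subseteq> hecke_reps N" by auto
  then have "finite (fst ` ?F)" using finite_hecke_reps[OF N] finite_subset by blast
  then show "finite ?F" using inj_fst finite_imageD by blast
  \<comment> \<open>Turns membership in \<open>I\<close> into a condition on \<open>Y\<close> and
    \<open>u\<close> alone, the same for both products.\<close>
  have det_iff: "real_of_int (det2 (\<mu> A X)) = real N * c u \<longleftrightarrow> real_of_int (det2 X) = c u"
    if "A \<in> hecke_reps N" for A X
  proof -
    have "real_of_int (det2 (\<mu> A X)) = real N * real_of_int (det2 X)"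
      using det that by (metis of_int_mult of_int_of_nat_eq)
    then show ?thesis using N by simp
  qed
  show "card ?F = (if u \<in> \<beta> \<and> real_of_int (det2 Y) = real N * c u
       then card {A \<in> hecke_reps N. Y \<in> range (\<mu> A)} else 0)"
  proof (cases "u \<in> \<beta> \<and> real_of_int (det2 Y) = real N * c u")
    case True
    have "fst ` ?F = {A \<in> hecke_reps N. Y \<in> range (\<mu> A)}"
    proof
      show "{A \<in> hecke_reps N. Y \<in> range (\<mu> A)} \<subseteq> fst ` ?F"
      proof
        fix A assume "A \<in> {A \<in> hecke_reps N. Y \<in> range (\<mu> A)}"
        then obtain X where A: "A \<in> hecke_reps N" and X: "Y = \<mu> A X" by auto
        then have "(A, X, u) \<in> ?F" using True det_iff[OF A] by (auto simp: I_def)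
        then show "A \<in> fst ` ?F" by force
      qed
    qed auto
    then show ?thesis using card_image[OF inj_fst] True by simp
  next
    case False
    have "?F = {}"
    proof (rule ccontr)
      assume "?F \<noteq> {}"
      then obtain A X where A: "A \<in> hecke_reps N" and "(X, u) \<in> I" "\<mu> A X = Y" by fastforce
      then show False using False det_iff[OF A, of X] by (auto simp: I_def)
    qed
    then show ?thesis unfolding if_not_P[OF False] by (simp only: card.empty)
  qed
qed

text \<open>\<open>lattice_count_transpose\<close> makes the fibres of both products equally large;
  \<open>h\<close> thus matches \<open>(A, X, u)\<close> with some \<open>(A', X', u)\<close> such
  that \<open>A\<^sup>T X = X' A'\<close>.\<close>

lemma hecke_mult_bij:
  fixes \<beta> :: "'u set" and c :: "'u \<Rightarrow> real"
  assumes N: "N > 0"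
  defines "I \<equiv> {(X, u). u \<in> \<beta> \<and> real_of_int (det2 X) = c u}"
  obtains h where "bij_betw h (hecke_reps N \<times> I) (hecke_reps N \<times> I)"
    "\<And>x. x \<in> hecke_reps N \<times> I \<Longrightarrow>
      (hecke_mult_right (fst (h x)) (fst (snd (h x))), snd (snd (h x))) =
      (hecke_mult_left (fst x) (fst (snd x)), snd (snd x))"
proof (rule bij_betw_of_card_fibres)
  have left: "\<forall>A\<in>hecke_reps N. \<forall>X. det2 (hecke_mult_left A X) = int N * det2 X"
    "\<forall>A\<in>hecke_reps N. inj (hecke_mult_left A)"
    and right: "\<forall>A\<in>hecke_reps N. \<forall>X. det2 (hecke_mult_right A X) = int N * det2 X"
    "\<forall>A\<in>hecke_reps N. inj (hecke_mult_right A)"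
    using det2_hecke_mult inj_hecke_mult by blast+
  note fibre_left = card_hecke_mult_fibre[where \<beta> = \<beta> and c = c, OF N left, folded I_def]
  note fibre_right = card_hecke_mult_fibre[where \<beta> = \<beta> and c = c, OF N right, folded I_def]
  fix y :: "int_mat2 \<times> 'u"
  obtain Y u where y: "y = (Y, u)" by (cases y)
  show "finite {x \<in> hecke_reps N \<times> I. (hecke_mult_left (fst x) (fst (snd x)), snd (snd x)) = y}"
    unfolding y by (rule fibre_left(1))
  show "finite {x \<in> hecke_reps N \<times> I. (hecke_mult_right (fst x) (fst (snd x)), snd (snd x)) = y}"
    unfolding y by (rule fibre_right(1))
  obtain y1 y2 y3 y4 where Y: "Y = (y1, y2, y3, y4)" by (cases Y)
  have "card {A \<in> hecke_reps N. Y \<in> range (hecke_mult_left A)} =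
      card {A \<in> hecke_reps N. Y \<in> range (hecke_mult_right A)}"
    unfolding Y range_hecke_mult_left range_hecke_mult_right
    using lattice_count_transpose[OF N] unfolding lattice_count_def .
  then show "card {x \<in> hecke_reps N \<times> I. (hecke_mult_left (fst x) (fst (snd x)), snd (snd x)) = y} =
      card {x \<in> hecke_reps N \<times> I. (hecke_mult_right (fst x) (fst (snd x)), snd (snd x)) = y}"
    unfolding y by (simp only: fibre_left(2) fibre_right(2))
qed (use that in blast)

section \<open>The Hecke symmetry\<close>

text \<open>The signs and positions are chosen such that \<open>Q_Ztilde\<close> becomes
  \<open>(z, 1) X (z', 1)\<^sup>T\<close> up to terms in \<open>w\<close>, and \<open>q\<close> becomes \<open>- det X - S[u]/2\<close>.\<close>

fun lattice_vec :: "int_mat2 \<times> real Matrix.vec \<Rightarrow> real Matrix.vec" where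
  "lattice_vec ((x1, x2, x3, x4), u) =
    lvec (real_of_int x4) (real_of_int x3) u (real_of_int x2) (- real_of_int x1)"

section \<open>Cosets of L in its dual, in coordinates\<close>

lemma lattice_L_add:
  assumes "x \<in> lattice_L S" "y \<in> lattice_L S"
  shows "x + y \<in> lattice_L S"
  using assms by (auto simp: lattice_L_def)

lemma lattice_L_minus:
  assumes "x \<in> lattice_L S" "y \<in> lattice_L S"
  shows "x - y \<in> lattice_L S"
  using assms by (auto simp: lattice_L_def)

context posdef_form
begin

lemma lattice_L_subset_dual: "lattice_L S \<subseteq> dual_lattice S"
proof
  fix x assume x: "x \<in> lattice_L S"
  have "(map_mat real_of_int (Qmat S) *\<^sub>v x) $ i \<in> \<int>" if "i < m + 4" for i
    using x S that Qmat_carrier[OF S]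
    by (auto simp: lattice_L_def scalar_prod_def intro!: Ints_sum Ints_mult)
  then show "x \<in> dual_lattice S"
    using x S Qmat_carrier[OF S] by (auto simp: dual_lattice_def lattice_L_def)
qed

lemma dual_lattice_add:
  assumes "x \<in> dual_lattice S" "y \<in> dual_lattice S"
  shows "x + y \<in> dual_lattice S"
proof -
  have "map_mat real_of_int (Qmat S) *\<^sub>v (x + y) = map_mat of_int (Qmat S) *\<^sub>v x + map_mat of_int (Qmat S) *\<^sub>v y"
    using assms S Qmat_carrier[OF S]
    by (intro mult_add_distrib_mat_vec[of _ "m + 4" "m + 4"]) (auto simp: dual_lattice_def)
  then show ?thesis using assms lattice_L_add by (auto simp: dual_lattice_def)
qed

text \<open>Row \<open>m + 3 - i\<close> of \<open>Q\<close> is the unit vector at \<open>i\<close>,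
  so \<open>l $ i\<close> is an entry of the integral vector \<open>Q l\<close>.\<close>

lemma dual_lattice_corner_int:
  assumes l: "l \<in> dual_lattice S" and i: "i \<in> {0, 1, m + 2, m + 3}"
  shows "l $ i \<in> \<int>"
proof -
  define j where "j = m + 3 - i"
  have j: "j < m + 4" using i by (auto simp: j_def)
  have lc: "l \<in> carrier_vec (m + 4)" using l S by (auto simp: dual_lattice_def)
  have "row (map_mat real_of_int (Qmat S)) j = unit_vec (m + 4) i"
    using S i by (intro eq_vecI) (auto simp: j_def Qmat_def Let_def)
  then have "(map_mat real_of_int (Qmat S) *\<^sub>v l) $ j = l $ i"
    using j i lc Qmat_carrier[OF S] by (auto simp: scalar_prod_left_unit[OF lc])
  moreover have "(map_mat real_of_int (Qmat S) *\<^sub>v l) $ j \<in> \<int>"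
    using l j S by (auto simp: dual_lattice_def lattice_L_def)
  ultimately show ?thesis by simp
qed

lemma discriminant_cosetE:
  assumes "\<alpha> \<in> discriminant_group S"
  obtains x where "x \<in> dual_lattice S" "\<alpha> = {l \<in> dual_lattice S. x - l \<in> lattice_L S}"
  using assms unfolding discriminant_group_def by (rule quotientE) auto

lemma coset_closed:
  assumes \<alpha>: "\<alpha> \<in> discriminant_group S" and l: "l \<in> \<alpha>" and v: "v \<in> lattice_L S"
  shows "l + v \<in> \<alpha>"
proof -
  obtain x where x: "x \<in> dual_lattice S" "\<alpha> = {l \<in> dual_lattice S. x - l \<in> lattice_L S}"
    using discriminant_cosetE[OF \<alpha>] .
  have "l + v \<in> dual_lattice S" using l v x lattice_L_subset_dual by (intro dual_lattice_add) auto
  moreover have "x - (l + v) = (x - l) - v"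
    using x l v by (intro eq_vecI) (auto simp: dual_lattice_def lattice_L_def)
  ultimately show ?thesis using l v x lattice_L_minus by auto
qed

lemma coset_carrier: "\<alpha> \<in> discriminant_group S \<Longrightarrow> l \<in> \<alpha> \<Longrightarrow> l \<in> dual_lattice S \<and> l \<in> carrier_vec (m + 4)"
  using S by (auto elim!: discriminant_cosetE simp: dual_lattice_def)

text \<open>The corners of a vector in \<open>\<alpha>\<close> are integers and may be changed by
  arbitrary integers within \<open>\<alpha>\<close>, so the coset condition falls on the middle part
  alone.\<close>

lemma bij_betw_embed:
  assumes \<alpha>: "\<alpha> \<in> discriminant_group S"
  shows "bij_betw lattice_vec
    {(X, u). u \<in> {u \<in> carrier_vec m. lvec 0 0 u 0 0 \<in> \<alpha>} \<and> real_of_int (det2 X) = - n - quad S u / 2}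
    {l \<in> \<alpha>. qform S l = n}"
    (is "bij_betw _ ?I ?X")
proof (rule bij_betw_imageI)
  show "inj_on lattice_vec ?I"
  proof (rule inj_onI)
    fix i i' assume "i \<in> ?I" "i' \<in> ?I" and eq: "lattice_vec i = lattice_vec i'"
    obtain x1 x2 x3 x4 u where i: "i = ((x1, x2, x3, x4), u)" by (metis prod.exhaust)
    obtain y1 y2 y3 y4 v where i': "i' = ((y1, y2, y3, y4), v)" by (metis prod.exhaust)
    have uv: "u \<in> carrier_vec m" "v \<in> carrier_vec m" using \<open>i \<in> ?I\<close> \<open>i' \<in> ?I\<close> by (auto simp: i i')
    have "u = v" using arg_cong[OF eq, of mid] by (simp add: i i')
    moreover have "x4 = y4" "x3 = y3" "x2 = y2" "x1 = y1"
      using arg_cong[OF eq, of "\<lambda>l. l $ 0"] arg_cong[OF eq, of "\<lambda>l. l $ 1"]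
        arg_cong[OF eq, of "\<lambda>l. l $ (m + 2)"] arg_cong[OF eq, of "\<lambda>l. l $ (m + 3)"]
      by (simp_all only: i i' lattice_vec.simps lvec_index[OF uv(1)] lvec_index[OF uv(2)] of_int_eq_iff neg_equal_iff_equal)
    ultimately show "i = i'" by (simp add: i i')
  qed
  have shift: "lvec a b u c d + lvec a' b' (0\<^sub>v m) c' d' = lvec (a + a') (b + b') u (c + c') (d + d')"
    if "u \<in> carrier_vec m" for a b c d a' b' c' d' :: real and u
    using that by (simp add: lvec_add[where m = m])
  have int: "lvec a b (0\<^sub>v m) c d \<in> lattice_L S" if "a \<in> \<int>" "b \<in> \<int>" "c \<in> \<int>" "d \<in> \<int>" for a b c d :: real
    using that S by (auto simp: lattice_L_def lvec_def)
  show "lattice_vec ` ?I = ?X"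
  proof
    show "lattice_vec ` ?I \<subseteq> ?X"
    proof
      fix l assume "l \<in> lattice_vec ` ?I"
      then obtain x1 x2 x3 x4 u where u: "u \<in> carrier_vec m" "lvec 0 0 u 0 0 \<in> \<alpha>"
        and det: "real_of_int (det2 (x1, x2, x3, x4)) = - n - quad S u / 2"
        and l: "l = lattice_vec ((x1, x2, x3, x4), u)" by auto
      have "lvec 0 0 u 0 0 + lvec (real_of_int x4) (real_of_int x3) (0\<^sub>v m) (real_of_int x2) (- real_of_int x1) \<in> \<alpha>"
        by (rule coset_closed[OF \<alpha> u(2) int]) auto
      then have "l \<in> \<alpha>" by (simp add: shift[OF u(1)] l)
      moreover have "qform S l = n" using det by (simp add: l qform_lvec[OF S u(1)] algebra_simps)
      ultimately show "l \<in> ?X" by simp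
    qed
    show "?X \<subseteq> lattice_vec ` ?I"
    proof
      fix l assume "l \<in> ?X"
      then have l: "l \<in> \<alpha>" "qform S l = n" by auto
      have lc: "l \<in> carrier_vec (m + 4)" and ld: "l \<in> dual_lattice S" using coset_carrier[OF \<alpha> l(1)] by auto
      obtain x4 where x4: "l $ 0 = real_of_int x4" using dual_lattice_corner_int[OF ld, of 0] by (auto elim: Ints_cases)
      obtain x3 where x3: "l $ 1 = real_of_int x3" using dual_lattice_corner_int[OF ld, of 1] by (auto elim: Ints_cases)
      obtain x2 where x2: "l $ (m + 2) = real_of_int x2"
        using dual_lattice_corner_int[OF ld, of "m + 2"] by (auto elim: Ints_cases)
      have "- (l $ (m + 3)) \<in> \<int>" using dual_lattice_corner_int[OF ld, of "m + 3"] by simp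
      then obtain x1 where x1: "- (l $ (m + 3)) = real_of_int x1" by (rule Ints_cases)
      have l_eq: "l = lattice_vec ((x1, x2, x3, x4), mid l)"
        using lvec_eta[OF lc] unfolding lattice_vec.simps x1[symmetric] x2[symmetric] x3[symmetric] x4[symmetric]
        by simp
      have "l + lvec (- real_of_int x4) (- real_of_int x3) (0\<^sub>v m) (- real_of_int x2) (real_of_int x1) \<in> \<alpha>"
        by (rule coset_closed[OF \<alpha> l(1) int]) auto
      then have "lvec 0 0 (mid l) 0 0 \<in> \<alpha>"
        by (subst (asm) l_eq) (simp add: shift[OF mid_carrier[OF lc]])
      moreover have "real_of_int (det2 (x1, x2, x3, x4)) = - n - quad S (mid l) / 2"
        using l(2) by (subst (asm) l_eq) (simp add: qform_lvec[OF S mid_carrier[OF lc]] algebra_simps)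
      ultimately have "((x1, x2, x3, x4), mid l) \<in> ?I" using lc by auto
      with l_eq show "l \<in> lattice_vec ` ?I" by blast
    qed
  qed
qed

text \<open>\<open>q_lambda_Z\<close> at the transformed points, in terms of \<open>Y = A\<^sup>T X\<close> or \<open>Y = X A\<close>; the group element
  contributes the factor \<open>1/d\<close> to \<open>Q_Ztilde\<close> and \<open>N/d\<^sup>2\<close> to \<open>Q1 (Im Z)\<close>.\<close>

fun hecke_value :: "nat \<Rightarrow> complex triple \<Rightarrow> int_mat2 \<Rightarrow> real Matrix.vec \<Rightarrow> real" where
  "hecke_value N (z, w, z') (y1, y2, y3, y4) u =
    (cmod (of_int y1 * (z * z' - quad S w / 2) + of_int y2 * z + of_int y3 * z' + of_int y4
      - complex_of_real (sqrt (real N)) * bilin S (map_vec complex_of_real u) w))\<^sup>2 /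
    (2 * real N * (2 * Im z * Im z' - quad S (map_vec Im w)))"

section \<open>Hecke transformations of points\<close>

lemma hecke_rep_scaling:
  assumes A: "(a, b, d) \<in> hecke_reps N"
  shows "(sqrt (real N) / of_int d)\<^sup>2 = of_int a / of_int d"
    "real N = of_int a * of_int d" "real_of_int d > 0" "real_of_int a > 0"
proof -
  have N: "int N = a * d" and "d > 0" "a > 0" using A by (auto simp: hecke_reps_def)
  show "real N = of_int a * of_int d" using N by (metis of_int_mult of_int_of_nat_eq)
  then show "(sqrt (real N) / of_int d)\<^sup>2 = of_int a / of_int d"
    using \<open>d > 0\<close> \<open>a > 0\<close> by (simp add: power_divide power2_eq_square[of "real_of_int d"])
  show "real_of_int d > 0" "real_of_int a > 0" using \<open>d > 0\<close> \<open>a > 0\<close> by simp_all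
qed

lemma map_vec_Im_smult: "map_vec Im (complex_of_real c \<cdot>\<^sub>v w) = c \<cdot>\<^sub>v map_vec Im w"
  by (intro eq_vecI) auto

text \<open>The square of the factor \<open>sqrt N / d\<close> on \<open>w\<close> is
  \<open>a / d\<close>, by which the imaginary part of the transformed variable is also scaled;
  hence both terms of \<open>Q1\<close> scale alike.\<close>

lemma Q1_Im_act:
  assumes A: "A \<in> hecke_reps N" and w: "w \<in> carrier_vec m" and A_eq: "A = (a, b, d)"
  shows "Q1 S (Im_triple (act_first N A (z, w, z'))) =
      of_int a / of_int d * (2 * Im z * Im z' - quad S (map_vec Im w))"
    "Q1 S (Im_triple (act_last N A (z, w, z'))) =
      of_int a / of_int d * (2 * Im z * Im z' - quad S (map_vec Im w))"
proof -
  have v: "map_vec Im w \<in> carrier_vec m" using w by auto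
  have q: "quad S (map_vec Im (complex_of_real (sqrt (real N) / real_of_int d) \<cdot>\<^sub>v w)) =
      of_int a / of_int d * quad S (map_vec Im w)"
    by (simp only: map_vec_Im_smult quad_smult[OF S v] hecke_rep_scaling(1)[OF A[unfolded A_eq]])
  have Im_div: "Im ((of_int a * \<zeta> + of_int b) / of_int d) = of_int a / of_int d * Im \<zeta>" for \<zeta>
    using Im_divide_of_real[of "of_int a * \<zeta> + of_int b" "of_int d"] by simp
  show "Q1 S (Im_triple (act_first N A (z, w, z'))) =
      of_int a / of_int d * (2 * Im z * Im z' - quad S (map_vec Im w))"
    by (simp only: A_eq act_first_def act_last_def Q1_def Im_triple_def case_prod_conv q Im_div)
      (simp add: right_diff_distrib)
  show "Q1 S (Im_triple (act_last N A (z, w, z'))) =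
      of_int a / of_int d * (2 * Im z * Im z' - quad S (map_vec Im w))"
    by (simp only: A_eq act_first_def act_last_def Q1_def Im_triple_def case_prod_conv q Im_div)
      (simp add: right_diff_distrib)
qed

lemma act_in_domain_D:
  assumes A: "A \<in> hecke_reps N" and Z: "Z \<in> domain_D S"
  shows "act_first N A Z \<in> domain_D S" "act_last N A Z \<in> domain_D S"
proof -
  obtain a b d where A_eq: "A = (a, b, d)" by (cases A)
  obtain z w z' where Z_eq: "Z = (z, w, z')" by (cases Z)
  have w: "w \<in> carrier_vec m" and pos: "Im z > 0" "Im z' > 0" "2 * Im z * Im z' - quad S (map_vec Im w) > 0"
    using Z unfolding Z_eq domain_D_iff by auto
  note ad = hecke_rep_scaling(3,4)[OF A[unfolded A_eq]]
  have Im_div: "Im ((of_int a * \<zeta> + of_int b) / of_int d) = of_int a / of_int d * Im \<zeta>" for \<zeta>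
    using Im_divide_of_real[of "of_int a * \<zeta> + of_int b" "of_int d"] by simp
  have Q: "Q1 S (Im_triple (act_first N A Z)) > 0" "Q1 S (Im_triple (act_last N A Z)) > 0"
    unfolding Z_eq Q1_Im_act[OF A w A_eq] using ad pos by (intro mult_pos_pos divide_pos_pos; simp)+
  show "act_first N A Z \<in> domain_D S"
    using Q(1) w S ad pos by (simp add: A_eq Z_eq domain_D_def act_first_def Im_div del: Im_divide)
  show "act_last N A Z \<in> domain_D S"
    using Q(2) w S ad pos by (simp add: A_eq Z_eq domain_D_def act_last_def Im_div del: Im_divide)
qed

text \<open>Multiplying \<open>Q_Ztilde\<close> by \<open>d\<close> clears the denominators and
  leaves an expression in \<open>Z\<close>, \<open>u\<close> and the entries of the product
  matrix.\<close>

lemma q_lambda_Z_act: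
  assumes A: "A \<in> hecke_reps N" and Z: "Z \<in> domain_D S" and u: "u \<in> carrier_vec m"
  shows "q_lambda_Z S (lattice_vec (X, u)) (act_first N A Z) = hecke_value N Z (hecke_mult_left A X) u"
    "q_lambda_Z S (lattice_vec (X, u)) (act_last N A Z) = hecke_value N Z (hecke_mult_right A X) u"
proof -
  obtain a b d where A_eq: "A = (a, b, d)" by (cases A)
  obtain z w z' where Z_eq: "Z = (z, w, z')" by (cases Z)
  obtain x1 x2 x3 x4 where X: "X = (x1, x2, x3, x4)" by (cases X)
  have w: "w \<in> carrier_vec m" using Z unfolding Z_eq domain_D_iff by auto
  note scale = hecke_rep_scaling[OF A[unfolded A_eq]]
  define c where "c = complex_of_real (sqrt (real N) / real_of_int d)"
  have d: "(of_int d :: complex) \<noteq> 0" using scale(3) by auto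
  have c: "c\<^sup>2 = of_int a / of_int d" "of_int d * c = complex_of_real (sqrt (real N))"
    unfolding c_def of_real_power[symmetric] scale(1) using d by simp_all
  have cw: "c \<cdot>\<^sub>v w \<in> carrier_vec m" using w by simp
  have ru: "map_vec complex_of_real u \<in> carrier_vec m" using u by simp
  let ?q = "2 * Im z * Im z' - quad S (map_vec Im w)"
  define W where "W = quad S w / 2"
  define V where "V = bilin S (map_vec complex_of_real u) w"
  have quad_c: "quad S (c \<cdot>\<^sub>v w) / 2 = of_int a / of_int d * W"
    unfolding quad_smult[OF S w] c(1) W_def by simp
  have bilin_c: "bilin S (map_vec complex_of_real u) (c \<cdot>\<^sub>v w) = c * V"
    unfolding bilin_smult_right[OF S ru w] V_def ..
  \<comment> \<open>Uses \<open>N = a * d\<close>; for \<open>q = 0\<close> both sides are 0 by the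
    convention on division.\<close>
  have reduce: "(cmod E)\<^sup>2 / (2 * (of_int a / of_int d * q)) = (cmod (of_int d * E))\<^sup>2 / (2 * real N * q)"
    for E and q :: real
    using scale(3,4) unfolding scale(2) norm_mult
    by (cases "q = 0") (simp_all add: power_mult_distrib power2_eq_square[of "real_of_int d"] field_simps)
  have "of_int d * Q_Ztilde S (lattice_vec (X, u)) (act_first N A Z) =
      of_int (a * x1) * (z * z' - W) + of_int (a * x2) * z + of_int (b * x1 + d * x3) * z' + of_int (b * x2 + d * x4)
      - complex_of_real (sqrt (real N)) * V"
    unfolding Z_eq A_eq X act_first_def case_prod_conv lattice_vec.simps c_def[symmetric]
      Q_Ztilde_lvec[OF S sym u cw] quad_c bilin_c c(2)[symmetric]
    using d by (simp add: field_simps)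
  then show "q_lambda_Z S (lattice_vec (X, u)) (act_first N A Z) = hecke_value N Z (hecke_mult_left A X) u"
    unfolding q_lambda_Z_def Z_eq Q1_Im_act[OF A w A_eq] reduce
    by (simp add: A_eq X W_def V_def)
  have "of_int d * Q_Ztilde S (lattice_vec (X, u)) (act_last N A Z) =
      of_int (a * x1) * (z * z' - W) + of_int (b * x1 + d * x2) * z + of_int (a * x3) * z' + of_int (b * x3 + d * x4)
      - complex_of_real (sqrt (real N)) * V"
    unfolding Z_eq A_eq X act_last_def case_prod_conv lattice_vec.simps c_def[symmetric]
      Q_Ztilde_lvec[OF S sym u cw] quad_c bilin_c c(2)[symmetric]
    using d by (simp add: field_simps)
  then show "q_lambda_Z S (lattice_vec (X, u)) (act_last N A Z) = hecke_value N Z (hecke_mult_right A X) u"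
    unfolding q_lambda_Z_def Z_eq Q1_Im_act[OF A w A_eq] reduce
    by (simp add: A_eq X W_def V_def)
qed

lemma Phi_hecke_symmetry:
  assumes \<alpha>: "\<alpha> \<in> discriminant_group S" and n: "n < 0" and s: "Re s > kappa S / 2"
    and N: "N > 0" and Z: "Z \<in> domain_D S"
  shows "(\<Sum>A \<in> hecke_reps N. Phi S \<alpha> n (act_first N A Z) s) =
    (\<Sum>A \<in> hecke_reps N. Phi S \<alpha> n (act_last N A Z) s)"
proof -
  define H where "H = hecke_reps N"
  define X where "X = {l \<in> \<alpha>. qform S l = n}"
  define \<beta> where "\<beta> = {u \<in> carrier_vec m. lvec 0 0 u 0 0 \<in> \<alpha>}"
  define I where "I = {(X, u). u \<in> \<beta> \<and> real_of_int (det2 X) = - n - quad S u / 2}"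
  have bij: "bij_betw lattice_vec I X"
    unfolding I_def X_def \<beta>_def by (rule bij_betw_embed[OF \<alpha>])
  \<comment> \<open>The terms depend on \<open>A\<close> and \<open>X\<close> only through the
    product matrix, which is what \<open>h\<close> below preserves.\<close>
  define g where "g = (\<lambda>Y u. green_term S n s (hecke_value N Z Y u))"
  define f1 f2 where "f1 = (\<lambda>A (X, u). g (hecke_mult_left A X) u)" and "f2 = (\<lambda>A (X, u). g (hecke_mult_right A X) u)"
  obtain x where x: "\<alpha> = {l \<in> dual_lattice S. x - l \<in> lattice_L S}" "x \<in> dual_lattice S"
    using discriminant_cosetE[OF \<alpha>] by blast
  have X_sub: "X \<subseteq> {l \<in> quadric n. \<forall>i<m + 4. l $ i - x $ i \<in> \<int>}"
  proof
    fix l assume l: "l \<in> X"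
    then have lc: "l \<in> carrier_vec (m + 4)" using coset_carrier[OF \<alpha>] by (auto simp: X_def)
    have "l $ i - x $ i \<in> \<int>" if i: "i < m + 4" for i
    proof -
      have "(x - l) $ i \<in> \<int>" using l i S by (auto simp: X_def x lattice_L_def)
      then have "x $ i - l $ i \<in> \<int>" using i lc by simp
      then show ?thesis using Ints_minus by fastforce
    qed
    then show "l \<in> {l \<in> quadric n. \<forall>i<m + 4. l $ i - x $ i \<in> \<int>}"
      using l lc by (auto simp: X_def quadric_def)
  qed
  \<comment> \<open>A condition free of \<open>A\<close> and \<open>Z\<close> that decides the
    summability of every series on both sides.\<close>
  define summ where "summ \<longleftrightarrow> (\<lambda>l. height S l powr - (Re s + kappa S / 2 - 1)) summable_on X"
  have I_carrier: "u \<in> carrier_vec m" if "(Y, u) \<in> I" for Y u using that by (auto simp: I_def \<beta>_def)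
  have f1: "f1 A i = green_term S n s (q_lambda_Z S (lattice_vec i) (act_first N A Z))"
    and f2: "f2 A i = green_term S n s (q_lambda_Z S (lattice_vec i) (act_last N A Z))"
    if "A \<in> H" "i \<in> I" for A i
  proof -
    obtain Y u where i: "i = (Y, u)" by (cases i)
    show "f1 A i = green_term S n s (q_lambda_Z S (lattice_vec i) (act_first N A Z))"
      "f2 A i = green_term S n s (q_lambda_Z S (lattice_vec i) (act_last N A Z))"
      using that q_lambda_Z_act[of A N Z u Y] Z I_carrier[of Y u]
      by (simp_all only: i f1_def f2_def g_def H_def case_prod_conv)
  qed
  have f1_sum: "f1 A summable_on I \<longleftrightarrow> summ" if A: "A \<in> H" for A
  proof -
    have "f1 A summable_on I \<longleftrightarrow>
        (\<lambda>i. green_term S n s (q_lambda_Z S (lattice_vec i) (act_first N A Z))) summable_on I"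
      by (rule summable_on_cong) (rule f1[OF A])
    also have "\<dots> \<longleftrightarrow> (\<lambda>l. green_term S n s (q_lambda_Z S l (act_first N A Z))) summable_on X"
      by (rule summable_on_reindex_bij_betw[OF bij])
    also have "\<dots> \<longleftrightarrow> summ"
      unfolding summ_def by (rule summable_green_iff[OF act_in_domain_D(1)[OF A[unfolded H_def] Z] n s X_sub])
    finally show ?thesis .
  qed
  have f2_sum: "f2 A summable_on I \<longleftrightarrow> summ" if A: "A \<in> H" for A
  proof -
    have "f2 A summable_on I \<longleftrightarrow>
        (\<lambda>i. green_term S n s (q_lambda_Z S (lattice_vec i) (act_last N A Z))) summable_on I"
      by (rule summable_on_cong) (rule f2[OF A])
    also have "\<dots> \<longleftrightarrow> (\<lambda>l. green_term S n s (q_lambda_Z S l (act_last N A Z))) summable_on X"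
      by (rule summable_on_reindex_bij_betw[OF bij])
    also have "\<dots> \<longleftrightarrow> summ"
      unfolding summ_def by (rule summable_green_iff[OF act_in_domain_D(2)[OF A[unfolded H_def] Z] n s X_sub])
    finally show ?thesis .
  qed
  define C where "C = 2 * (Gamma (s + complex_of_real (kappa S) / 2 - 1) / Gamma (2 * s))"
  have Phi: "Phi S \<alpha> n (act_first N A Z) s = C * infsum (f1 A) I"
    "Phi S \<alpha> n (act_last N A Z) s = C * infsum (f2 A) I" if A: "A \<in> H" for A
    unfolding Phi_eq_infsum C_def X_def[symmetric] infsum_reindex_bij_betw[OF bij, symmetric]
    using f1[OF A] f2[OF A] by (auto intro!: infsum_cong)
  have "(\<Sum>A\<in>H. infsum (f1 A) I) = (\<Sum>A\<in>H. infsum (f2 A) I)"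
  proof (cases summ)
    case True
    obtain h where h: "bij_betw h (H \<times> I) (H \<times> I)"
      "\<And>x. x \<in> H \<times> I \<Longrightarrow> (hecke_mult_right (fst (h x)) (fst (snd (h x))), snd (snd (h x))) =
        (hecke_mult_left (fst x) (fst (snd x)), snd (snd x))"
      using hecke_mult_bij[OF N, of \<beta> "\<lambda>u. - n - quad S u / 2"] unfolding H_def I_def by blast
    have finH: "finite H" unfolding H_def by (rule finite_hecke_reps[OF N])
    have "(\<Sum>A\<in>H. infsum (f1 A) I) = infsum (\<lambda>(A, i). f1 A i) (H \<times> I)"
      using f1_sum True by (intro sum_infsum_Times finH) simp
    also have "\<dots> = infsum (\<lambda>x. (\<lambda>(A, i). f2 A i) (h x)) (H \<times> I)"
    proof (rule infsum_cong)
      fix x assume "x \<in> H \<times> I"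
      from h(2)[OF this] show "(\<lambda>(A, i). f1 A i) x = (\<lambda>(A, i). f2 A i) (h x)"
        by (simp add: f1_def f2_def split_beta)
    qed
    also have "\<dots> = infsum (\<lambda>(A, i). f2 A i) (H \<times> I)" by (rule infsum_reindex_bij_betw[OF h(1)])
    also have "\<dots> = (\<Sum>A\<in>H. infsum (f2 A) I)"
      using f2_sum True by (intro sum_infsum_Times[symmetric] finH) simp
    finally show ?thesis .
  next
    case False
    \<comment> \<open>\<open>infsum\<close> of a non-summable family is 0, so both sides
      vanish.\<close>
    then show ?thesis using f1_sum f2_sum by (simp add: infsum_not_exists)
  qed
  then show ?thesis by (simp add: Phi H_def[symmetric] sum_distrib_left[symmetric])
qed

end

theorem theorem6p2:
  fixes m N :: nat and S :: "int mat" and \<alpha> :: "real Matrix.vec set" and n :: real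
    and s :: complex and Z :: "complex triple"
  assumes "S \<in> carrier_mat m m" and "sym_mat S" and "even_mat S" and "pos_def_mat S"
    and "\<alpha> \<in> discriminant_group S"
    and "n \<in> {qform S l + of_int k | l k. l \<in> \<alpha>}" and "n < 0"
    and "Re s > kappa S / 2"
    and "N > 0"
    and "Z \<in> domain_D S"
    and "\<forall>A \<in> hecke_reps N. act_first N A Z \<notin> heegner S \<alpha> n"
    and "\<forall>A \<in> hecke_reps N. act_last N A Z \<notin> heegner S \<alpha> n"
  shows "(\<Sum>A \<in> hecke_reps N. Phi S \<alpha> n (act_first N A Z) s)
       = (\<Sum>A \<in> hecke_reps N. Phi S \<alpha> n (act_last N A Z) s)"
proof -
  interpret posdef_form m S by unfold_locales fact+
  show ?thesis by (rule Phi_hecke_symmetry) fact+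
qed

end
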